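(* Let $X_1,X_2,\ldots$ be i.i.d. nonnegative random variables and, for real $p$ and integers $k\ge1$, let $$\beta_k(p)=\mathbb{E}\left[\left(\frac{X_1+\dots+X_k}{k}\right)^p\right].$$ Let $n$ be a positive integer and let $a,b\in\mathbb{Z}_{>0}^n$ be partitions of the same integer such that $a\prec_{\mathrm{maj}}b$. Then for $p\in(-\infty,0]\cup[1,\infty)$ we have $$\prod_{j=1}^n\beta_{a_j}(p)\le\prod_{j=1}^n\beta_{b_j}(p),$$ and for $p\in(0,1)$ the inequality is reversed, i.e. $$\prod_{j=1}^n\beta_{a_j}(p)\ge\prod_{j=1}^n\beta_{b_j}(p).$$ In particular, the sequence $(\beta_k(p))_{k\ge1}$ is log-convex, i.e. $\beta_k(p)^2\le\beta_{k-1}(p)\beta_{k+1}(p)$ for all $k\ge2$, when $p\in(-\infty,0]\cup[1,\infty)$, and it is log-concave, i.e. $\beta_k(p)^2\ge\beta_{k-1}(p)\beta_{k+1}(p)$ for all $k\ge2$, when $p\in(0,1)$.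
   Context: A vector $a\in\mathbb{Z}_{>0}^n$ is a partition of an integer $m$ if its entries sum to $m$ (the entries need not be listed in any particular order). For $a,b\in\mathbb{R}^n$, write $a\prec_{\mathrm{maj}}b$ ($b$ majorizes $a$) if $\sum_{i=1}^j a_i^{\downarrow}\le\sum_{i=1}^j b_i^{\downarrow}$ for all $j=1,\dots,n$, with equality when $j=n$, where $\downarrow$ denotes rearrangement in decreasing order. The random variables are real-valued (finite). The moments $\beta_k(p)$ are understood as elements of $[0,+\infty]$, with the conventions $0^0=1$ and $0^p=+\infty$ for $p<0$. *)

theory Defs
  imports "HOL-Probability.Probability"
begin

text \<open>
  Real powers of nonnegative reals with values in \<open>[0, \<infinity>]\<close>. The case \<open>x = 0\<close> is treated
  separately because \<open>0 powr p = 0\<close> for every \<open>p\<close>, whereas here \<open>0\<^sup>0 = 1\<close> and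
  \<open>0\<^sup>p = \<infinity>\<close> for \<open>p < 0\<close>. The values at \<open>x < 0\<close> carry no meaning.
\<close>

definition ext_powr :: "real \<Rightarrow> real \<Rightarrow> ennreal" where
  "ext_powr x p =
     (if x = 0 then (if p = 0 then 1 else if p < 0 then \<infinity> else 0)
      else ennreal (x powr p))"

definition mean_moment :: "'a measure \<Rightarrow> (nat \<Rightarrow> 'a \<Rightarrow> real) \<Rightarrow> nat \<Rightarrow> real \<Rightarrow> ennreal" where
  "mean_moment M X k p =
     (\<integral>\<^sup>+ \<omega>. ext_powr ((\<Sum>i\<in>{1..k}. X i \<omega>) / real k) p \<partial>M)"

text \<open>Vectors of \<open>n\<close> entries are lists of length \<open>n\<close>.\<close>

definition is_partition :: "nat \<Rightarrow> nat \<Rightarrow> nat list \<Rightarrow> bool" where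
  "is_partition n m a \<longleftrightarrow> length a = n \<and> (\<forall>x\<in>set a. 0 < x) \<and> sum_list a = m"

definition decreasing_rearrangement :: "real list \<Rightarrow> real list" where
  "decreasing_rearrangement a = rev (sort a)"

text \<open>\<open>a \<prec>\<^sub>m\<^sub>a\<^sub>j b\<close>: the list \<open>b\<close> majorizes \<open>a\<close>.\<close>

definition majorized_by :: "real list \<Rightarrow> real list \<Rightarrow> bool"  (infix "\<prec>\<^sub>m\<^sub>a\<^sub>j" 50) where
  "a \<prec>\<^sub>m\<^sub>a\<^sub>j b \<longleftrightarrow>
     length a = length b \<and>
     (\<forall>j\<in>{1..length a}.
        (\<Sum>i<j. decreasing_rearrangement a ! i) \<le> (\<Sum>i<j. decreasing_rearrangement b ! i)) \<and>
     (\<Sum>i<length a. decreasing_rearrangement a ! i) =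
       (\<Sum>i<length a. decreasing_rearrangement b ! i)"

end

theory Submission imports Defs begin

text \<open>
  The inequality for products follows by Abel summation from log-convexity (log-concavity) of
  \<open>k \<mapsto> \<beta>\<^sub>k(p)\<close>.

  For \<open>p < 0\<close>, \<open>x\<^sup>p\<close> is a mixture of the functions \<open>exp(-t x)\<close>, and
  \<open>E exp(-t(X\<^sub>1 + \<dots> + X\<^sub>k)/k) = L(t/k)\<^sup>k\<close> is log-convex in \<open>k\<close> because \<open>k ln L(t/k)\<close> is the
  perspective of the convex function \<open>ln L\<close>.

  For \<open>0 < p < 2\<close>, \<open>x\<^sup>p\<close> is a mixture over \<open>r > 0\<close> of \<open>x/(x + r) = 1 - r/(x + r)\<close> or of
  \<open>x\<^sup>2/(x + r) = x - r + r\<^sup>2/(x + r)\<close>, and the excess of \<open>E[1/(X\<^sub>k + r)]\<close>, with \<open>X\<^sub>k\<close> the sample mean,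
  over its value for constant variables is log-convex in \<open>k\<close>. So \<open>\<beta>\<^sub>k(p)\<close> is concave in \<open>k\<close>
  for \<open>p < 1\<close> and log-convex for \<open>p > 1\<close>.

  For \<open>p \<ge> 2\<close>, log-convexity passes from \<open>p - 1\<close> to \<open>p\<close>, first for finitely supported laws by induction
  on the size of the support. Translate the law so that its smallest atom is \<open>0\<close>. Removing this atom
  is a binomial thinning, under which log-convexity at \<open>p\<close> is preserved because
  \<open>k ((k - 1)/k)\<^sup>p\<close> is convex in \<open>k\<close>. Then translate back: the derivative of \<open>\<beta>\<^sub>k(p)\<close> along
  \<open>X + t\<close> is \<open>p \<beta>\<^sub>k(p - 1)\<close>, and by AM-GM log-convexity at \<open>p - 1\<close> does not let log-convexity at
  \<open>p\<close> get lost. General laws are reached by monotone approximation.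
\<close>

section \<open>Binomial transforms and log-convexity\<close>

text \<open>The ratios b(j + 1)/b(j) are nondecreasing, so moving two indices apart increases the
  product. Division is avoided by multiplying the induction hypothesis with log-convexity at
  \<open>Suc l\<close> and cancelling \<open>b l\<close>.\<close>

lemma log_convex_seq_spread:
  fixes b :: "nat \<Rightarrow> real"
  assumes pos: "\<And>k. 1 \<le> k \<Longrightarrow> 0 < b k"
    and lc: "\<And>k. 2 \<le> k \<Longrightarrow> (b k)\<^sup>2 \<le> b (k - 1) * b (k + 1)"
    and "2 \<le> k" "k \<le> l"
  shows "b k * b l \<le> b (k - 1) * b (l + 1)"
  using \<open>k \<le> l\<close>
proof (induction l rule: dec_induct)
  case base
  show ?case using lc[OF \<open>2 \<le> k\<close>] by (simp add: power2_eq_square)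
next
  case (step l)
  have bl: "0 < b l" and bk: "0 \<le> b (k - 1)" and bsl: "0 < b (Suc l)"
    using step \<open>2 \<le> k\<close> pos[of l] pos[of "Suc l"] less_imp_le[OF pos[of "k - 1"]] by auto
  have *: "(b (Suc l))\<^sup>2 \<le> b l * b (Suc (Suc l))"
    using lc[of "Suc l"] step \<open>2 \<le> k\<close> by simp
  have "(b k * b (Suc l)) * b l = (b k * b l) * b (Suc l)"
    by simp
  also have "\<dots> \<le> (b (k - 1) * b (Suc l)) * b (Suc l)"
    using step.IH bsl by (intro mult_right_mono) auto
  also have "\<dots> = b (k - 1) * (b (Suc l))\<^sup>2"
    by (simp add: power2_eq_square)
  also have "\<dots> \<le> b (k - 1) * (b l * b (Suc (Suc l)))"
    using * bk by (intro mult_left_mono) auto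
  also have "\<dots> = (b (k - 1) * b (Suc (Suc l))) * b l"
    by simp
  finally show ?case
    using bl by simp
qed

text \<open>The coefficient of u^(k + l - m) in the product of the k-th and l-th binomial transforms
  of g (\<open>binomial_transform_mult\<close>). For thinned laws, m is the number of nonzero
  variables among k + l.\<close>

definition split_sum :: "(nat \<Rightarrow> real) \<Rightarrow> nat \<Rightarrow> nat \<Rightarrow> nat \<Rightarrow> real" where
  "split_sum g m k l = (\<Sum>n\<le>m. real (k choose n) * real (l choose (m - n)) * (g n * g (m - n)))"

lemma split_sum_commute: "split_sum g m k l = split_sum g m l k"
  unfolding split_sum_def
  by (rule sum.reindex_bij_witness[of _ "\<lambda>n. m - n" "\<lambda>n. m - n"]) auto

lemma times_binomial_pred: "real k * real ((k - 1) choose n) = (real k - real n) * real (k choose n)"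
proof (cases "n \<le> k")
  case True
  have "(k - n) * (k choose n) = k * ((k - 1) choose n)"
    by (rule binomial_absorb_comp)
  then have "real (k - n) * real (k choose n) = real k * real ((k - 1) choose n)"
    by (metis of_nat_mult)
  with True show ?thesis by (simp add: of_nat_diff)
next
  case False
  then show ?thesis by (simp add: binomial_eq_0)
qed

text \<open>The two binomials count the ways to mark m of k + l positions, n of them in the first
  block. Deleting one of the k + l - m unmarked positions shortens either the first or the second
  block.\<close>

lemma split_sum_rec:
  "(real k + real l - real m) * split_sum g m k l =
     real k * split_sum g m (k - 1) l + real l * split_sum g m k (l - 1)"
proof -
  have "real k * (real ((k - 1) choose n) * real (l choose (m - n)) * G) +
        real l * (real (k choose n) * real ((l - 1) choose (m - n)) * G) =
        (real k + real l - real m) * (real (k choose n) * real (l choose (m - n)) * G)"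
    if "n \<le> m" for n G
  proof -
    have "real k * (real ((k - 1) choose n) * real (l choose (m - n)) * G) +
        real l * (real (k choose n) * real ((l - 1) choose (m - n)) * G) =
        (real k * real ((k - 1) choose n)) * real (l choose (m - n)) * G +
        real (k choose n) * (real l * real ((l - 1) choose (m - n))) * G"
      by (simp add: algebra_simps)
    also have "\<dots> = ((real k - real n) + (real l - real (m - n))) *
        (real (k choose n) * real (l choose (m - n)) * G)"
      unfolding times_binomial_pred by (simp add: algebra_simps)
    finally show ?thesis using that by (simp add: of_nat_diff)
  qed
  then show ?thesis
    unfolding split_sum_def sum_distrib_left sum.distrib[symmetric]
    by (intro sum.cong) auto
qed

lemma split_sum_small: "k + l < m \<Longrightarrow> split_sum g m k l = 0"
  unfolding split_sum_def by (intro sum.neutral) (auto simp: binomial_eq_0_iff)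

lemma split_sum_diag: "split_sum g (k + l) k l = g k * g l"
proof -
  have "split_sum g (k + l) k l =
      (\<Sum>n\<le>k + l. if n = k then g k * g l else 0)"
    unfolding split_sum_def
    by (intro sum.cong) (auto simp: binomial_eq_0_iff)
  then show ?thesis by simp
qed

text \<open>The factor left over when \<open>split_sum_rec\<close> is rewritten for coefficients
  divided by (k l)^p: the term with k - 1 picks up k from the recurrence and ((k - 1)/k)^p from the
  change of normalisation.\<close>

definition lag_weight :: "real \<Rightarrow> nat \<Rightarrow> real" where
  "lag_weight p j = real j * ((real j - 1) / real j) powr p"

text \<open>The endpoint 0 matters because (k - 2)/(k - 1) vanishes at k = 2; there the claim
  reduces to u^p <= u for u in [0, 1].\<close>

lemma powr_convex_combination:
  fixes x y u v p :: real
  assumes "1 \<le> p" "0 \<le> x" "0 \<le> y" "0 \<le> u" "0 \<le> v" "u + v = 1"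
  shows "(u * x + v * y) powr p \<le> u * x powr p + v * y powr p"
proof -
  have aux: "(u * y) powr p \<le> u * y powr p" if "0 \<le> u" "u \<le> 1" "0 \<le> y" for u y
  proof (cases "u = 0")
    case False
    then have "u powr p \<le> u powr 1"
      using that assms(1) by (intro powr_mono') auto
    then show ?thesis using that False by (simp add: powr_mult mult_right_mono)
  qed (use assms in auto)
  show ?thesis
  proof (cases "x = 0 \<or> y = 0")
    case True
    then show ?thesis
      using aux[of u x] aux[of v y] assms by auto
  next
    case False
    then have xy: "x \<in> {0<..}" "y \<in> {0<..}" using assms by auto
    have u: "u = 1 - v" using assms by simp
    have "v \<le> 1" using assms by simp
    then show ?thesis
      using convex_onD[OF powr_convex[OF assms(1)] assms(5) _ xy] by (simp add: u)
  qed
qed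

text \<open>Perspective of the convex function \<open>t \<mapsto> t\<^sup>p\<close>; this is where \<open>p \<ge> 1\<close> is used.\<close>
lemma lag_weight_convex:
  assumes "1 \<le> p" "2 \<le> k"
  shows "2 * lag_weight p k \<le> lag_weight p (k - 1) + lag_weight p (k + 1)"
proof -
  define x where "x = real k"
  have x: "2 \<le> x" "real (k - 1) = x - 1" "real (k + 1) = x + 1"
    using assms by (auto simp: x_def)
  \<comment> \<open>The weights (k - 1)/(2k) and (k + 1)/(2k) add up to 1, and with them (k - 2)/(k
    - 1) and k/(k + 1) average to (k - 1)/k.\<close>
  have "((x - 1) / (2*x) * ((x - 2) / (x - 1)) + (x + 1) / (2*x) * (x / (x + 1))) powr p
      \<le> (x - 1) / (2*x) * ((x - 2) / (x - 1)) powr p + (x + 1) / (2*x) * (x / (x + 1)) powr p"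
    using x assms by (intro powr_convex_combination) (auto simp: field_simps)
  also have "(x - 1) / (2*x) * ((x - 2) / (x - 1)) + (x + 1) / (2*x) * (x / (x + 1)) = (x - 1) / x"
    using x(1) by (simp add: divide_simps) (simp add: algebra_simps)
  finally have "2 * x * ((x - 1) / x) powr p \<le> 2 * x * ((x - 1) / (2*x) * ((x - 2) / (x - 1)) powr p + (x + 1) / (2*x) * (x / (x + 1)) powr p)"
    using x by (intro mult_left_mono) auto
  also have "\<dots> = (x - 1) * ((x - 2) / (x - 1)) powr p + (x + 1) * (x / (x + 1)) powr p"
    using x by (simp add: field_simps)
  finally show ?thesis
    unfolding lag_weight_def x x_def[symmetric] by (simp add: algebra_simps)
qed

lemma lag_weight_spread:
  assumes "1 \<le> p" "2 \<le> k" "k \<le> l"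
  shows "lag_weight p k + lag_weight p l \<le> lag_weight p (k - 1) + lag_weight p (l + 1)"
  using \<open>k \<le> l\<close>
proof (induction l rule: dec_induct)
  case base
  show ?case using lag_weight_convex[OF assms(1,2)] by simp
next
  case (step l)
  then show ?case using lag_weight_convex[OF assms(1), of "Suc l"] assms(2) by simp
qed

text \<open>Induction on k + l. Below m both sides vanish, and at m a single term survives and the
  claim is log-convexity of g(n)/n^p. Above m the recurrence expresses c(k, l) by pairs of sum k + l
  - 1: the induction hypothesis moves both pairs outwards, \<open>lag_weight_spread\<close> moves
  the weights outwards, and the recurrence, whose factor k + l - m has not changed, is read
  backwards.\<close>

lemma split_sum_step:
  fixes g :: "nat \<Rightarrow> real"
  assumes p: "1 \<le> p" and g0: "g 0 = 0" and pos: "\<And>n. 1 \<le> n \<Longrightarrow> 0 < g n"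
    and lc: "\<And>n. 2 \<le> n \<Longrightarrow> (g n / real n powr p)\<^sup>2 \<le>
      (g (n - 1) / real (n - 1) powr p) * (g (n + 1) / real (n + 1) powr p)"
    and "2 \<le> k" "k \<le> l"
  shows "split_sum g m k l / (real k * real l) powr p \<le>
    split_sum g m (k - 1) (l + 1) / (real (k - 1) * real (l + 1)) powr p"
proof -
  define c where "c k l = split_sum g m k l / (real k * real l) powr p" for k l
  have c_comm: "c k l = c l k" for k l
    by (simp add: c_def split_sum_commute[of g m k l] mult.commute)
  have g_nonneg: "0 \<le> g n" for n
    using g0 pos[of n] by (cases n) auto
  have c_nonneg: "0 \<le> c k l" for k l
    unfolding c_def split_sum_def by (intro divide_nonneg_nonneg sum_nonneg mult_nonneg_nonneg g_nonneg) auto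
  have lag1: "lag_weight p 1 = 0" using p by (simp add: lag_weight_def)
  have split1: "real k * split_sum g m (k - 1) l / (real k * real l) powr p = lag_weight p k * c (k - 1) l"
    if "1 \<le> k" "1 \<le> l" for k l
  \<comment> \<open>At k = 1 the normalisation of c(0, l) degenerates, but both sides are 0:
    \<open>g 0 = 0\<close> kills the coefficient on the left, and \<open>lag_weight p 1 = 0\<close>
    the right side.\<close>
  proof (cases "k = 1")
    case True
    have "split_sum g m 0 l = 0"
      unfolding split_sum_def by (intro sum.neutral) (auto simp: g0 binomial_eq_0_iff)
    with True lag1 show ?thesis by simp
  next
    case False
    then have k: "2 \<le> k" using that by auto
    have "(real k * real l) * ((real k - 1) / real k) = real (k - 1) * real l"
      using k by (simp add: of_nat_diff)
    then have "(real k * real l) powr p * ((real k - 1) / real k) powr p = (real (k - 1) * real l) powr p"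
      using powr_mult[of "real k * real l" "(real k - 1) / real k" p] by simp
    moreover have "(real k * real l) powr p > 0" "(real (k - 1) * real l) powr p > 0"
      using k that by auto
    ultimately show ?thesis
      unfolding c_def lag_weight_def
      by (simp add: field_simps)
  qed
  have rec: "(real k + real l - real m) * c k l = lag_weight p k * c (k - 1) l + lag_weight p l * c k (l - 1)"
    if "1 \<le> k" "1 \<le> l" for k l
  proof -
    have "(real k + real l - real m) * c k l =
       real k * split_sum g m (k - 1) l / (real k * real l) powr p +
       real l * split_sum g m k (l - 1) / (real k * real l) powr p"
      unfolding c_def times_divide_eq_right split_sum_rec by (simp add: add_divide_distrib)
    also have "real l * split_sum g m k (l - 1) / (real k * real l) powr p =
        real l * split_sum g m (l - 1) k / (real l * real k) powr p"
      by (subst split_sum_commute) (simp add: mult.commute)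
    finally show ?thesis
      using split1[OF that] split1[OF that(2,1)] by (simp add: c_comm)
  qed
  have "c k l \<le> c (k - 1) (l + 1)" if "k + l = N" "2 \<le> k" "k \<le> l" for N k l
    using that
  proof (induction N arbitrary: k l rule: less_induct)
    case (less N)
    consider "N < m" | "N = m" | "m < N" by linarith
    then show ?case
    proof cases
      case 1
      then show ?thesis using less.prems by (simp add: c_def split_sum_small)
    next
      case 2
      define b where "b n = g n / real n powr p" for n
      have "b k * b l \<le> b (k - 1) * b (l + 1)"
        using less.prems pos lc by (intro log_convex_seq_spread) (auto simp: b_def)
      moreover have "c k l = b k * b l"
        using 2 less.prems split_sum_diag[of g k l] by (simp add: c_def b_def powr_mult)
      moreover have "c (k - 1) (l + 1) = b (k - 1) * b (l + 1)"
        using 2 less.prems split_sum_diag[of g "k - 1" "l + 1"]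
        by (simp add: c_def b_def powr_mult)
      ultimately show ?thesis by simp
    next
      case 3
      \<comment> \<open>For k = l the pair (k, l - 1) is out of order, but then both sides agree by
        symmetry of c.\<close>
      have *: "c k (l - 1) \<le> c (k - 1) l"
      proof (cases "k = l")
        case True
        then show ?thesis using c_comm by simp
      next
        case False
        then show ?thesis
          using less.IH[of "N - 1" k "l - 1"] less.prems by auto
      qed
      have **: "lag_weight p (k - 1) * c (k - 1) l \<le> lag_weight p (k - 1) * c (k - 2) (l + 1)"
      proof (cases "k = 2")
        case True
        then show ?thesis using lag1 by simp
      next
        case False
        then have "c (k - 1) l \<le> c (k - 2) (l + 1)"
          using less.IH[of "N - 1" "k - 1" l] less.prems by (simp add: numeral_2_eq_2)
        then show ?thesis
          by (intro mult_left_mono) (auto simp: lag_weight_def)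
      qed
      have "(real k + real l - real m) * c k l = lag_weight p k * c (k - 1) l + lag_weight p l * c k (l - 1)"
        using less.prems by (intro rec) auto
      also have "\<dots> \<le> lag_weight p k * c (k - 1) l + lag_weight p l * c (k - 1) l"
        using * by (intro add_mono mult_left_mono) (auto simp: lag_weight_def)
      also have "\<dots> = (lag_weight p k + lag_weight p l) * c (k - 1) l"
        by (simp add: algebra_simps)
      also have "\<dots> \<le> (lag_weight p (k - 1) + lag_weight p (l + 1)) * c (k - 1) l"
        using lag_weight_spread[OF p less.prems(2,3)] c_nonneg by (intro mult_right_mono) auto
      also have "\<dots> \<le> lag_weight p (k - 1) * c (k - 2) (l + 1) + lag_weight p (l + 1) * c (k - 1) l"
        using ** by (simp add: algebra_simps)
      also have "\<dots> = (real (k - 1) + real (l + 1) - real m) * c (k - 1) (l + 1)"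
        using rec[of "k - 1" "l + 1"] less.prems by (simp add: numeral_2_eq_2)
      also have "real (k - 1) + real (l + 1) - real m = real k + real l - real m"
        using less.prems by (simp add: of_nat_diff)
      finally show ?thesis
        using 3 less.prems by (subst (asm) mult_le_cancel_left_pos) auto
    qed
  qed
  from this[OF refl \<open>2 \<le> k\<close> \<open>k \<le> l\<close>] show ?thesis by (simp add: c_def)
qed

lemma binomial_transform_mult:
  fixes g :: "nat \<Rightarrow> real" and u :: real
  defines "A \<equiv> \<lambda>k. \<Sum>n\<le>k. real (k choose n) * u ^ (k - n) * g n"
  shows "A k * A l = (\<Sum>m\<le>k + l. u ^ (k + l - m) * split_sum g m k l)"
proof -
  \<comment> \<open>Padding with zeros puts the rectangle of the product and the triangle i + j <= k
    + l under one summand.\<close>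
  define P where "P k n = (if n \<le> k then real (k choose n) * u ^ (k - n) * g n else 0)" for k n
  have A: "A k = (\<Sum>n\<le>N. P k n)" if "k \<le> N" for k N
    unfolding A_def P_def using that
    by (intro sum.mono_neutral_cong_left) auto
  have "A k * A l = (\<Sum>i\<le>k + l. \<Sum>j\<le>k + l. P k i * P l j)"
    by (simp add: A[of k "k + l"] A[of l "k + l"] sum_product)
  also have "\<dots> = (\<Sum>(i, j)\<in>{..k + l} \<times> {..k + l}. P k i * P l j)"
    by (rule sum.cartesian_product)
  also have "\<dots> = (\<Sum>(i, j)\<in>{(i, j). i + j \<le> k + l}. P k i * P l j)"
  proof (rule sum.mono_neutral_cong_right)
    show "{(i, j). i + j \<le> k + l} \<subseteq> {..k + l} \<times> {..k + l}" by auto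
  qed (auto simp: P_def split: if_splits)
  also have "\<dots> = (\<Sum>m\<le>k + l. \<Sum>i\<le>m. P k i * P l (m - i))"
    by (rule sum.triangle_reindex_eq)
  also have "\<dots> = (\<Sum>m\<le>k + l. u ^ (k + l - m) * split_sum g m k l)"
  proof (rule sum.cong[OF refl])
    fix m assume "m \<in> {..k + l}"
    have "P k i * P l (m - i) = u ^ (k + l - m) * (real (k choose i) * real (l choose (m - i)) * (g i * g (m - i)))"
      if "i \<le> m" for i
    proof (cases "i \<le> k \<and> m - i \<le> l")
      case True
      then have "k + l - m = (k - i) + (l - (m - i))" using that by auto
      then have "u ^ (k + l - m) = u ^ (k - i) * u ^ (l - (m - i))" by (simp only: power_add)
      with True show ?thesis by (simp add: P_def)
    qed (auto simp: P_def)
    then show "(\<Sum>i\<le>m. P k i * P l (m - i)) = u ^ (k + l - m) * split_sum g m k l"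
      unfolding split_sum_def sum_distrib_left by (intro sum.cong) auto
  qed
  finally show ?thesis .
qed

text \<open>Since (k - 1) + (k + 1) = k + k, both sides are polynomials in u >= 0 with the same
  powers, and \<open>split_sum_step\<close> with k = l compares them coefficient by
  coefficient.\<close>

lemma binomial_transform_log_convex:
  fixes g :: "nat \<Rightarrow> real" and u p :: real
  defines "A \<equiv> \<lambda>k. \<Sum>n\<le>k. real (k choose n) * u ^ (k - n) * g n"
  assumes p: "1 \<le> p" and u: "0 \<le> u" and g0: "g 0 = 0" and pos: "\<And>n. 1 \<le> n \<Longrightarrow> 0 < g n"
    and lc: "\<And>n. 2 \<le> n \<Longrightarrow> (g n / real n powr p)\<^sup>2 \<le>
      (g (n - 1) / real (n - 1) powr p) * (g (n + 1) / real (n + 1) powr p)"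
    and k: "2 \<le> k"
  shows "(A k / real k powr p)\<^sup>2 \<le> (A (k - 1) / real (k - 1) powr p) * (A (k + 1) / real (k + 1) powr p)"
proof -
  have kk: "k - 1 + (k + 1) = k + k" using k by simp
  have "(A k / real k powr p)\<^sup>2 = A k * A k / (real k * real k) powr p"
    by (simp add: power2_eq_square powr_mult)
  also have "\<dots> = (\<Sum>m\<le>k + k. u ^ (k + k - m) * (split_sum g m k k / (real k * real k) powr p))"
    unfolding A_def binomial_transform_mult sum_divide_distrib by simp
  also have "\<dots> \<le> (\<Sum>m\<le>k + k. u ^ (k + k - m) * (split_sum g m (k - 1) (k + 1) / (real (k - 1) * real (k + 1)) powr p))"
    using u k by (intro sum_mono mult_left_mono split_sum_step p g0 pos lc) auto
  also have "\<dots> = A (k - 1) * A (k + 1) / (real (k - 1) * real (k + 1)) powr p"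
    unfolding A_def binomial_transform_mult sum_divide_distrib kk by simp
  also have "\<dots> = (A (k - 1) / real (k - 1) powr p) * (A (k + 1) / real (k + 1) powr p)"
    by (simp add: powr_mult)
  finally show ?thesis .
qed

text \<open>If \<open>u, v, z\<close> have derivatives proportional to \<open>u1, v1, z1\<close> and \<open>v1\<^sup>2 \<le> u1 z1\<close>, then
  wherever \<open>u z < v\<^sup>2\<close> the AM-GM inequality makes \<open>u z / v\<^sup>2\<close> increase.\<close>
lemma log_convexity_propagates:
  fixes u v z u1 v1 z1 :: "real \<Rightarrow> real"
  assumes cont: "continuous_on {0..} u" "continuous_on {0..} v" "continuous_on {0..} z"
    and du: "\<And>t. 0 < t \<Longrightarrow> (u has_real_derivative p * u1 t) (at t)"
    and dv: "\<And>t. 0 < t \<Longrightarrow> (v has_real_derivative p * v1 t) (at t)"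
    and dz: "\<And>t. 0 < t \<Longrightarrow> (z has_real_derivative p * z1 t) (at t)"
    and p: "0 \<le> p"
    and pos: "\<And>t. 0 < t \<Longrightarrow> 0 < u t" "\<And>t. 0 < t \<Longrightarrow> 0 < z t" "\<And>t. 0 \<le> t \<Longrightarrow> 0 < v t"
    and nonneg1: "\<And>t. 0 < t \<Longrightarrow> 0 \<le> u1 t" "\<And>t. 0 < t \<Longrightarrow> 0 \<le> v1 t" "\<And>t. 0 < t \<Longrightarrow> 0 \<le> z1 t"
    and lc1: "\<And>t. 0 < t \<Longrightarrow> (v1 t)\<^sup>2 \<le> u1 t * z1 t"
    and start: "(v 0)\<^sup>2 \<le> u 0 * z 0" and h: "0 \<le> h"
  shows "(v h)\<^sup>2 \<le> u h * z h"
proof (rule ccontr)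
  assume "\<not> ?thesis"
  then have neg: "u h * z h < (v h)\<^sup>2" by simp
  define G where "G t = u t * z t / (v t)\<^sup>2" for t
  have contG: "continuous_on {0..} G"
    unfolding G_def using pos(3) by (intro continuous_intros cont) (force)
  \<comment> \<open>Its largest element \<open>h0\<close> is the last time at which the inequality
    holds. Between \<open>h0\<close> and h one has u z < v^2, so G cannot fall there from at least 1
    to below 1.\<close>
  define T where "T = {t \<in> {0..h}. 1 \<le> G t}"
  have "0 \<in> T" using start h pos(3)[of 0] by (simp add: T_def G_def)
  have "compact T"
  proof -
    have "closed ({0..h} \<inter> G -` {1..})"
      using continuous_on_subset[OF contG, of "{0..h}"] by (intro continuous_closed_preimage) auto
    moreover have "{0..h} \<inter> G -` {1..} = T" by (auto simp: T_def)
    moreover have "T \<subseteq> {0..h}" by (auto simp: T_def)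
    ultimately show ?thesis 
      by (metis bounded_closed_interval bounded_subset compact_eq_bounded_closed)
  qed
  with \<open>0 \<in> T\<close> obtain h0 where h0: "h0 \<in> T" "\<And>t. t \<in> T \<Longrightarrow> t \<le> h0"
    using compact_attains_sup[of T] by auto
  have Gh: "G h < 1" using neg pos(3)[OF h] by (simp add: G_def)
  have "h0 \<noteq> h" using h0(1) Gh by (auto simp: T_def)
  then have "0 \<le> h0" "h0 < h" "1 \<le> G h0" using h0(1) by (auto simp: T_def)
  have "G h0 \<le> G h"
  proof (rule DERIV_nonneg_imp_increasing_open[where f = G])
    show "h0 \<le> h" using \<open>h0 < h\<close> by simp
    show "continuous_on {h0..h} G"
      by (rule continuous_on_subset[OF contG]) (use \<open>0 \<le> h0\<close> in auto)
    fix t assume t: "h0 < t" "t < h"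
    then have t0: "0 < t" using \<open>0 \<le> h0\<close> by simp
    have "t \<notin> T" using h0(2)[of t] t by auto
    then have "G t < 1" using t t0 by (auto simp: T_def)
    then have less: "u t * z t < (v t)\<^sup>2" using pos(3)[of t] t0 by (simp add: G_def)
    note P = pos(1)[OF t0] pos(2)[OF t0] pos(3)[of t]
    have vt: "0 < v t" using P t0 by simp
    \<comment> \<open>AM-GM in the form (x + y)^2 >= 4 x y, with x = u1 z v and y = u z1 v. The
      product x y is then bounded below by v1^2 <= u1 z1 and u z < v^2.\<close>
    have "(u1 t * z t * v t + u t * z1 t * v t)\<^sup>2 \<ge> 4 * ((u1 t * z t * v t) * (u t * z1 t * v t))"
      using four_x_squared zero_le_power2[of "u1 t * z t * v t - u t * z1 t * v t"]
      by (simp add: power2_eq_square algebra_simps)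
    also have "4 * ((u1 t * z t * v t) * (u t * z1 t * v t)) = 4 * (u1 t * z1 t) * (u t * z t) * (v t)\<^sup>2"
      by (simp add: power2_eq_square)
    also have "\<dots> \<ge> 4 * (v1 t)\<^sup>2 * (u t * z t) * (u t * z t)"
    proof -
      have "(v1 t)\<^sup>2 * (u t * z t) * (u t * z t) \<le> (u1 t * z1 t) * (u t * z t) * (v t)\<^sup>2"
        using lc1[OF t0] less P nonneg1[OF t0] by (intro mult_mono) auto
      then show ?thesis by linarith
    qed
    also have "4 * (v1 t)\<^sup>2 * (u t * z t) * (u t * z t) = (2 * v1 t * (u t * z t))\<^sup>2"
      by (simp add: power2_eq_square)
    finally have "(2 * v1 t * (u t * z t))\<^sup>2 \<le> (u1 t * z t * v t + u t * z1 t * v t)\<^sup>2" .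
    then have key: "2 * v1 t * (u t * z t) \<le> u1 t * z t * v t + u t * z1 t * v t"
      using P nonneg1[OF t0] vt by (intro power2_le_imp_le[of "2 * v1 t * (u t * z t)"]) auto
    define D where "D = ((p * u1 t * z t + u t * (p * z1 t)) * (v t)\<^sup>2 - u t * z t * (2 * v t * (p * v1 t))) / ((v t)\<^sup>2)\<^sup>2"
    have G': "(G has_real_derivative D) (at t)"
      unfolding G_def D_def
      by (rule derivative_eq_intros du[OF t0] dv[OF t0] dz[OF t0] refl)+
        (use vt in \<open>simp_all add: power2_eq_square algebra_simps\<close>)
    have "(p * u1 t * z t + u t * (p * z1 t)) * (v t)\<^sup>2 - u t * z t * (2 * v t * (p * v1 t)) =
        p * v t * ((u1 t * z t * v t + u t * z1 t * v t) - 2 * v1 t * (u t * z t))"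
      by (simp add: power2_eq_square algebra_simps)
    then have "0 \<le> D"
      unfolding D_def using key p vt by simp
    with G' show "\<exists>y. (G has_real_derivative y) (at t) \<and> 0 \<le> y" by blast
  qed
  with \<open>1 \<le> G h0\<close> Gh show False by simp
qed

section \<open>Expectations under finitely supported laws\<close>

text \<open>\<open>fin_exp w S k g\<close> is \<open>E g(X\<^sub>1 + \<dots> + X\<^sub>k)\<close> for i.i.d. variables with mass \<open>w y\<close> at
  \<open>y \<in> S\<close>; the total mass need not be 1.\<close>
primrec fin_exp :: "(real \<Rightarrow> real) \<Rightarrow> real set \<Rightarrow> nat \<Rightarrow> (real \<Rightarrow> real) \<Rightarrow> real" where
  "fin_exp w S 0 g = g 0"
| "fin_exp w S (Suc k) g = (\<Sum>y\<in>S. w y * fin_exp w S k (\<lambda>s. g (s + y)))"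

text \<open>Sums of k atoms that are all at least a stay above k a, so f and g are compared only
  there. A positive a keeps functions like 1/s away from their pole.\<close>

lemma fin_exp_mono:
  assumes "\<And>y. y \<in> S \<Longrightarrow> 0 \<le> w y" "\<And>y. y \<in> S \<Longrightarrow> a \<le> y"
    and "\<And>s. real k * a \<le> s \<Longrightarrow> f s \<le> g s"
  shows "fin_exp w S k f \<le> fin_exp w S k g"
  using assms(3)
proof (induction k arbitrary: f g)
  case (Suc k)
  have "f (s + y) \<le> g (s + y)" if "y \<in> S" "real k * a \<le> s" for s y
    using Suc.prems[of "s + y"] assms(2)[OF that(1)] that(2) by (simp add: algebra_simps)
  then show ?case
    unfolding fin_exp.simps using assms(1) by (intro sum_mono mult_left_mono Suc.IH) auto
qed simp

lemma fin_exp_cong: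
  assumes "\<And>y. y \<in> S \<Longrightarrow> a \<le> y" "\<And>s. real k * a \<le> s \<Longrightarrow> f s = g s"
  shows "fin_exp w S k f = fin_exp w S k g"
  using assms(2)
proof (induction k arbitrary: f g)
  case (Suc k)
  have "f (s + y) = g (s + y)" if "y \<in> S" "real k * a \<le> s" for s y
    using Suc.prems[of "s + y"] assms(1)[OF that(1)] that(2) by (simp add: algebra_simps)
  then show ?case
    unfolding fin_exp.simps by (intro sum.cong refl arg_cong2[of _ _ _ _ "(*)"] Suc.IH) auto
qed simp

lemma fin_exp_add: "fin_exp w S k (\<lambda>s. f s + g s) = fin_exp w S k f + fin_exp w S k g"
  by (induction k arbitrary: f g) (simp_all add: distrib_left sum.distrib)

lemma fin_exp_cmult: "fin_exp w S k (\<lambda>s. c * g s) = c * fin_exp w S k g"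
  by (induction k arbitrary: g) (simp_all add: sum_distrib_left mult.left_commute)

lemma fin_exp_const: "fin_exp w S k (\<lambda>_. c) = (\<Sum>y\<in>S. w y) ^ k * c"
  by (induction k) (simp_all add: sum_distrib_right mult.assoc)

lemma fin_exp_scale_weight: "fin_exp (\<lambda>y. c * w y) S k g = c ^ k * fin_exp w S k g"
  by (induction k arbitrary: g) (simp_all add: sum_distrib_left mult_ac)

lemma fin_exp_id:
  assumes "(\<Sum>y\<in>S. w y) = 1"
  shows "fin_exp w S k (\<lambda>s. s) = real k * (\<Sum>y\<in>S. w y * y)"
proof (induction k)
  case (Suc k)
  have "fin_exp w S (Suc k) (\<lambda>s. s) = (\<Sum>y\<in>S. w y * (real k * (\<Sum>y\<in>S. w y * y) + y))"
    by (simp add: fin_exp_add fin_exp_const assms Suc)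
  also have "(\<Sum>y\<in>S. w y * (c + y)) = c * (\<Sum>y\<in>S. w y) + (\<Sum>y\<in>S. w y * y)" for c
    by (simp add: distrib_left sum.distrib sum_distrib_left mult.commute)
  finally show ?case by (simp add: assms algebra_simps)
qed simp

lemma fin_exp_exp: "fin_exp w S k (\<lambda>s. exp (- (t * s))) = (\<Sum>y\<in>S. w y * exp (- (t * y))) ^ k"
proof (induction k)
  case (Suc k)
  have "fin_exp w S (Suc k) (\<lambda>s. exp (- (t * s))) =
      (\<Sum>y\<in>S. w y * fin_exp w S k (\<lambda>s. exp (- (t * y)) * exp (- (t * s))))"
    by (simp add: exp_add[symmetric] algebra_simps)
  then show ?case by (simp add: fin_exp_cmult Suc sum_distrib_right mult.assoc)
qed simp

lemma fin_exp_nonneg: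
  assumes "\<And>y. y \<in> S \<Longrightarrow> 0 \<le> w y" "\<And>y. y \<in> S \<Longrightarrow> 0 \<le> y" "\<And>s. 0 \<le> s \<Longrightarrow> 0 \<le> g s"
  shows "0 \<le> fin_exp w S k g"
  using fin_exp_mono[of S w 0 k "\<lambda>_. 0" g] assms by (simp add: fin_exp_const)

lemma fin_exp_pos:
  assumes "finite S" "\<And>y. y \<in> S \<Longrightarrow> 0 \<le> w y" "\<And>y. y \<in> S \<Longrightarrow> 0 \<le> y" "0 < (\<Sum>y\<in>S. w y)"
    and "\<And>s. 0 \<le> s \<Longrightarrow> 0 < g s"
  shows "0 < fin_exp w S k g"
  using assms(5)
proof (induction k arbitrary: g)
  case (Suc k)
  obtain y0 where y0: "y0 \<in> S" "w y0 \<noteq> 0"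
    using assms(4) by (metis less_irrefl sum.neutral)
  have pos: "0 < fin_exp w S k (\<lambda>s. g (s + y))" if "y \<in> S" for y
    using assms(3)[OF that] Suc.prems by (intro Suc.IH) auto
  have "0 < w y0 * fin_exp w S k (\<lambda>s. g (s + y0))"
    using pos y0 assms(2)[OF y0(1)] by simp
  then show ?case
    unfolding fin_exp.simps using assms(1,2) pos y0(1) by (intro sum_pos2[of S y0]) (auto simp: less_imp_le)
qed simp

lemma has_real_derivative_fin_exp:
  assumes "\<And>y. y \<in> S \<Longrightarrow> a \<le> y"
    and "\<And>s. real k * a \<le> s \<Longrightarrow> ((\<lambda>t. G t s) has_real_derivative G' s) (at t)"
  shows "((\<lambda>t. fin_exp w S k (G t)) has_real_derivative fin_exp w S k G') (at t)"
  using assms(2)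
proof (induction k arbitrary: G G')
  case (Suc k)
  have "((\<lambda>t. G t (s + y)) has_real_derivative G' (s + y)) (at t)" if "y \<in> S" "real k * a \<le> s" for s y
    using Suc.prems[of "s + y"] assms(1)[OF that(1)] that(2) by (simp add: algebra_simps)
  then show ?case
    unfolding fin_exp.simps by (intro DERIV_sum DERIV_cmult Suc.IH) auto
qed simp

lemma continuous_on_fin_exp:
  assumes "\<And>y. y \<in> S \<Longrightarrow> a \<le> y"
    and "\<And>s. real k * a \<le> s \<Longrightarrow> continuous_on T (\<lambda>t. G t s)"
  shows "continuous_on T (\<lambda>t. fin_exp w S k (G t))"
  using assms(2)
proof (induction k arbitrary: G)
  case (Suc k)
  have "continuous_on T (\<lambda>t. G t (s + y))" if "y \<in> S" "real k * a \<le> s" for s y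
    using Suc.prems[of "s + y"] assms(1)[OF that(1)] that(2) by (simp add: algebra_simps)
  then show ?case
    unfolding fin_exp.simps by (intro continuous_intros Suc.IH) auto
qed simp

text \<open>The shift of the sum is k h so that the sample mean moves by h whatever k is: one
  translated law serves all k at once.\<close>

lemma fin_exp_shift:
  "fin_exp w S k (\<lambda>s. g (s + real k * h)) = fin_exp (\<lambda>y. w (y - h)) ((\<lambda>y. y + h) ` S) k g"
proof (induction k arbitrary: g)
  case (Suc k)
  have "fin_exp w S (Suc k) (\<lambda>s. g (s + real (Suc k) * h)) =
      (\<Sum>y\<in>S. w y * fin_exp w S k (\<lambda>s. g ((s + real k * h) + (y + h))))"
    by (simp add: algebra_simps)
  also have "\<dots> = (\<Sum>y\<in>S. w y * fin_exp (\<lambda>y. w (y - h)) ((\<lambda>y. y + h) ` S) k (\<lambda>s. g (s + (y + h))))"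
    using Suc[of "\<lambda>s. g (s + (y + h))" for y] by simp
  also have "\<dots> = fin_exp (\<lambda>y. w (y - h)) ((\<lambda>y. y + h) ` S) (Suc k) g"
    by (simp add: sum.reindex)
  finally show ?case .
qed simp

text \<open>Condition on the number n of variables that avoid the atom 0. The law on the remaining
  atoms is not renormalised. The induction on k is Pascal's rule.\<close>

lemma fin_exp_binomial:
  assumes "finite S" "0 \<in> S"
  shows "fin_exp w S k g = (\<Sum>n\<le>k. real (k choose n) * w 0 ^ (k - n) * fin_exp w (S - {0}) n g)"
proof (induction k arbitrary: g)
  case (Suc k)
  define F where "F n = fin_exp w (S - {0}) n g" for n
  define c where "c n = real (k choose n) * w 0 ^ (k - n)" for n
  have "fin_exp w S (Suc k) g = w 0 * fin_exp w S k g + (\<Sum>y\<in>S - {0}. w y * fin_exp w S k (\<lambda>s. g (s + y)))"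
    using assms by (simp add: sum.remove)
  also have "(\<Sum>y\<in>S - {0}. w y * fin_exp w S k (\<lambda>s. g (s + y))) =
      (\<Sum>y\<in>S - {0}. \<Sum>n\<le>k. c n * (w y * fin_exp w (S - {0}) n (\<lambda>s. g (s + y))))"
    by (simp add: Suc c_def sum_distrib_left mult_ac)
  also have "\<dots> = (\<Sum>n\<le>k. c n * F (Suc n))"
    by (subst sum.swap) (simp add: F_def sum_distrib_left)
  also have "w 0 * fin_exp w S k g = (\<Sum>n\<le>k. real (k choose n) * w 0 ^ (Suc k - n) * F n)"
    unfolding Suc F_def sum_distrib_left by (intro sum.cong) (auto simp: Suc_diff_le)
  also have "\<dots> = (\<Sum>n\<le>Suc k. real (k choose n) * w 0 ^ (Suc k - n) * F n)"
    by simp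
  also have "\<dots> = w 0 ^ Suc k * F 0 + (\<Sum>n\<le>k. real (k choose Suc n) * w 0 ^ (k - n) * F (Suc n))"
    by (subst sum.atMost_Suc_shift) simp
  finally have "fin_exp w S (Suc k) g = w 0 ^ Suc k * F 0 +
      (\<Sum>n\<le>k. real (Suc k choose Suc n) * w 0 ^ (k - n) * F (Suc n))"
    by (simp add: c_def sum.distrib algebra_simps)
  also have "\<dots> = (\<Sum>n\<le>Suc k. real (Suc k choose n) * w 0 ^ (Suc k - n) * F n)"
    by (subst sum.atMost_Suc_shift) simp
  finally show ?case by (simp add: F_def)
qed simp

text \<open>Finite sums commute with the integral. The functions are constrained only for s >= 0,
  where the sums of nonnegative atoms lie.\<close>

lemma nn_integral_fin_exp:
  assumes "finite S" "\<And>y. y \<in> S \<Longrightarrow> 0 \<le> w y" "\<And>y. y \<in> S \<Longrightarrow> 0 \<le> y"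
    and "\<And>x s. 0 \<le> s \<Longrightarrow> 0 \<le> G x s" "\<And>s. 0 \<le> s \<Longrightarrow> (\<lambda>x. G x s) \<in> borel_measurable N"
    and "\<And>s. 0 \<le> s \<Longrightarrow> 0 \<le> I s" "\<And>s. 0 \<le> s \<Longrightarrow> (\<integral>\<^sup>+x. ennreal (G x s) \<partial>N) = ennreal (I s)"
  shows "(\<lambda>x. fin_exp w S k (G x)) \<in> borel_measurable N \<and>
    (\<integral>\<^sup>+x. ennreal (fin_exp w S k (G x)) \<partial>N) = ennreal (fin_exp w S k I)"
  using assms(4-7)
proof (induction k arbitrary: G I)
  case (Suc k)
  have IH: "(\<lambda>x. fin_exp w S k (\<lambda>s. G x (s + y))) \<in> borel_measurable N"
    "(\<integral>\<^sup>+x. ennreal (fin_exp w S k (\<lambda>s. G x (s + y))) \<partial>N) = ennreal (fin_exp w S k (\<lambda>s. I (s + y)))"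
    if "y \<in> S" for y
    using Suc.IH[of "\<lambda>x s. G x (s + y)" "\<lambda>s. I (s + y)"] Suc.prems assms(3)[OF that] by auto
  have nn: "0 \<le> fin_exp w S k (\<lambda>s. G x (s + y))" "0 \<le> fin_exp w S k (\<lambda>s. I (s + y))" if "y \<in> S" for x y
    using Suc.prems assms(2,3) that by (auto intro!: fin_exp_nonneg)
  have "(\<integral>\<^sup>+x. ennreal (fin_exp w S (Suc k) (G x)) \<partial>N) =
      (\<integral>\<^sup>+x. (\<Sum>y\<in>S. ennreal (w y) * ennreal (fin_exp w S k (\<lambda>s. G x (s + y)))) \<partial>N)"
    using assms(2) nn by (simp add: sum_ennreal[symmetric] ennreal_mult mult_nonneg_nonneg)
  also have "\<dots> = (\<Sum>y\<in>S. ennreal (w y) * ennreal (fin_exp w S k (\<lambda>s. I (s + y))))"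
    using IH by (simp add: nn_integral_sum nn_integral_cmult)
  also have "\<dots> = ennreal (fin_exp w S (Suc k) I)"
    using assms(2) nn by (simp add: sum_ennreal[symmetric] ennreal_mult mult_nonneg_nonneg)
  finally show ?case using IH(1) by simp
qed simp

text \<open>The defect \<open>E[1/Y\<^sub>k] - 1/E Y\<close> of the sample means \<open>Y\<^sub>k\<close> is log-convex in \<open>k\<close>. With
  \<open>L\<close> the Laplace transform, it is minus the value at \<open>0\<close> of
  \<open>\<Theta>\<^sub>k = L\<^bsup>k+1\<^esup>/(-L') - E[(k/S\<^sub>k) exp(-t S\<^sub>k)]\<close>, which vanishes at infinity and whose derivative is
  \<open>L\<^sup>k\<close> times a nonnegative factor independent of \<open>k\<close>.\<close>
lemma fin_exp_inverse_mean:
  assumes S: "finite S" "\<And>y. y \<in> S \<Longrightarrow> 0 < y" and w: "\<And>y. y \<in> S \<Longrightarrow> 0 \<le> w y" "(\<Sum>y\<in>S. w y) = 1"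
    and k: "2 \<le> k" and c: "0 < (c::real)"
  defines "d \<equiv> \<lambda>k. fin_exp w S k (\<lambda>s. real k / s) - 1 / (\<Sum>y\<in>S. w y * y)"
  shows "2 * d k \<le> c * d (k - 1) + d (k + 1) / c"
proof -
  have "S \<noteq> {}" using w(2) by auto
  define a where "a = Min S"
  have a: "0 < a" "\<And>y. y \<in> S \<Longrightarrow> a \<le> y"
    unfolding a_def using S \<open>S \<noteq> {}\<close> by auto
  define L where "L t = (\<Sum>y\<in>S. w y * exp (- (t * y)))" for t
  define N where "N t = (\<Sum>y\<in>S. w y * y * exp (- (t * y)))" for t
  define V where "V t = (\<Sum>y\<in>S. w y * y\<^sup>2 * exp (- (t * y)))" for t
  define \<Theta> where "\<Theta> k t = L t ^ (k + 1) / N t - fin_exp w S k (\<lambda>s. real k / s * exp (- (t * s)))" for k t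
  have dL: "(L has_real_derivative - N t) (at t)" for t
    unfolding L_def N_def
    by (auto intro!: derivative_eq_intros sum.cong simp: sum_negf[symmetric])
  have dN: "(N has_real_derivative - V t) (at t)" for t
    unfolding N_def V_def
    by (auto intro!: derivative_eq_intros sum.cong simp: sum_negf[symmetric] power2_eq_square)
  have Lpos: "0 < L t" for t
  proof -
    obtain y0 where "y0 \<in> S" "w y0 \<noteq> 0" using w(2) by (metis sum.neutral zero_neq_one)
    then show ?thesis
      unfolding L_def using S(1) w(1) by (intro sum_pos2[of S y0]) (auto simp: order_less_le)
  qed
  have LN: "a * L t \<le> N t" for t
    unfolding L_def N_def sum_distrib_left
    using a(2) w(1) by (intro sum_mono) (simp add: mult.left_commute mult.assoc mult_left_mono mult_right_mono)
  then have Npos: "0 < N t" for t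
    using mult_pos_pos[OF a(1) Lpos[of t]] by (rule order.strict_trans2[rotated])
  have CS: "(N t)\<^sup>2 \<le> L t * V t" for t
  proof -
    \<comment> \<open>Up to the factor L, this is the variance of the law tilted by exp(-t y), whose
      mean is N/L.\<close>
    have "0 \<le> (\<Sum>y\<in>S. w y * exp (- (t * y)) * (y - N t / L t)\<^sup>2)"
      using w(1) by (intro sum_nonneg) auto
    also have "\<dots> = (\<Sum>y\<in>S. w y * y\<^sup>2 * exp (- (t * y)) - 2 * (N t / L t) * (w y * y * exp (- (t * y)))
        + (N t / L t)\<^sup>2 * (w y * exp (- (t * y))))"
      by (intro sum.cong) (auto simp: power2_eq_square algebra_simps)
    also have "\<dots> = V t - 2 * (N t / L t) * N t + (N t / L t)\<^sup>2 * L t"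
      unfolding V_def[of t] N_def[of t] L_def[of t]
      by (simp only: sum.distrib sum_subtractf sum_distrib_left)
    also have "\<dots> = V t - (N t)\<^sup>2 / L t"
      using Lpos[of t] by (simp add: power2_eq_square)
    finally show ?thesis using Lpos[of t] by (simp add: field_simps)
  qed
  have d\<Theta>: "(\<Theta> j has_real_derivative L t ^ j * ((L t * V t - (N t)\<^sup>2) / (N t)\<^sup>2)) (at t)" if j: "1 \<le> j" for j t
  proof -
    have "((\<lambda>t. fin_exp w S j (\<lambda>s. real j / s * exp (- (t * s)))) has_real_derivative
        fin_exp w S j (\<lambda>s. - real j * exp (- (t * s)))) (at t)"
    proof (rule has_real_derivative_fin_exp[OF a(2)])
      fix s assume "real j * a \<le> s"
      then have "0 < s" using a(1) j by (smt (verit) mult_pos_pos of_nat_0_less_iff less_eq_Suc_le One_nat_def)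
      then show "((\<lambda>t. real j / s * exp (- (t * s))) has_real_derivative - real j * exp (- (t * s))) (at t)"
        by (auto intro!: derivative_eq_intros)
    qed
    moreover have "fin_exp w S j (\<lambda>s. - real j * exp (- (t * s))) = - real j * L t ^ j"
      unfolding fin_exp_cmult fin_exp_exp L_def ..
    ultimately have 1: "((\<lambda>t. fin_exp w S j (\<lambda>s. real j / s * exp (- (t * s)))) has_real_derivative
        - real j * L t ^ j) (at t)" by simp
    have 2: "((\<lambda>t. L t ^ (j + 1) / N t) has_real_derivative
        (((real j + 1) * L t ^ j * (- N t)) * N t - L t ^ (j + 1) * (- V t)) / (N t * N t)) (at t)"
      by (rule derivative_eq_intros dL dN refl)+ (use Npos[of t] in auto)
    have "(((real j + 1) * L t ^ j * (- N t)) * N t - L t ^ (j + 1) * (- V t)) / (N t * N t) - (- real j * L t ^ j)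
        = L t ^ j * ((L t * V t - (N t)\<^sup>2) / (N t)\<^sup>2)"
      using Npos[of t] by (simp add: field_simps power2_eq_square)
    with DERIV_diff[OF 2 1] show ?thesis by (simp add: \<Theta>_def[abs_def])
  qed
  have \<Theta>_lim: "(\<Theta> j \<longlongrightarrow> 0) at_top" if j: "1 \<le> j" for j
  proof -
    have L0: "(L \<longlongrightarrow> 0) at_top"
    proof -
      have "((\<lambda>t. w y * exp (- (t * y))) \<longlongrightarrow> w y * 0) at_top" if "y \<in> S" for y
      proof (intro tendsto_intros)
        show "((\<lambda>t. exp (- (t * y))) \<longlongrightarrow> 0) at_top"
          using S(2)[OF that] by real_asymp
      qed
      from tendsto_sum[OF this] show ?thesis by (simp add: L_def[abs_def])
    qed
    have Lj: "((\<lambda>t. L t ^ j / a) \<longlongrightarrow> 0) at_top"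
      using tendsto_divide[OF tendsto_power[OF L0, of j] tendsto_const[of a]] a(1) j
      by (simp add: zero_power Suc_le_eq)
    \<comment> \<open>Both terms of \<Theta> lie between 0 and L^j/a: the first by a L <= N, the
      second because s >= j a. As all atoms are positive, L tends to 0.\<close>
    have "\<bar>\<Theta> j t\<bar> \<le> L t ^ j / a" for t
    proof -
      have 1: "L t ^ (j + 1) / N t \<le> L t ^ j / a"
      proof -
        have "L t ^ j * (a * L t) \<le> L t ^ j * N t"
          using LN[of t] Lpos[of t] by (intro mult_left_mono) auto
        then show ?thesis using a(1) Npos[of t] by (simp add: field_simps)
      qed
      have "fin_exp w S j (\<lambda>s. real j / s * exp (- (t * s))) \<le> fin_exp w S j (\<lambda>s. 1 / a * exp (- (t * s)))"
      proof (rule fin_exp_mono[OF w(1) a(2)])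
        fix s assume s: "real j * a \<le> s"
        then have "0 < s" using a(1) j by (smt (verit) mult_pos_pos of_nat_0_less_iff less_eq_Suc_le One_nat_def)
        then show "real j / s * exp (- (t * s)) \<le> 1 / a * exp (- (t * s))"
          using s a(1) by (intro mult_right_mono) (auto simp: field_simps)
      qed
      then have 2: "fin_exp w S j (\<lambda>s. real j / s * exp (- (t * s))) \<le> L t ^ j / a"
        unfolding fin_exp_cmult fin_exp_exp L_def by simp
      have 3: "0 \<le> fin_exp w S j (\<lambda>s. real j / s * exp (- (t * s)))"
        using S(2) w(1) by (intro fin_exp_nonneg) (auto simp: less_imp_le)
      have "0 \<le> L t ^ (j + 1) / N t" using Lpos[of t] Npos[of t] by auto
      with 1 2 3 show ?thesis unfolding \<Theta>_def by linarith
    qed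
    then show ?thesis
      by (intro Lim_null_comparison[OF _ Lj]) auto
  qed
  \<comment> \<open>The three derivatives share the factors L^(k - 1) and K, and what remains is the
    square (c - L)^2/c. So F increases to its limit 0, which makes F(0) nonpositive.\<close>
  define F where "F t = c * \<Theta> (k - 1) t - 2 * \<Theta> k t + \<Theta> (k + 1) t / c" for t
  have "F 0 \<le> F t" if "0 \<le> t" for t
  proof (rule DERIV_nonneg_imp_nondecreasing[OF that])
    fix x
    define K where "K = (L x * V x - (N x)\<^sup>2) / (N x)\<^sup>2"
    have "(F has_real_derivative c * (L x ^ (k - 1) * K) - 2 * (L x ^ k * K) + L x ^ (k + 1) * K / c) (at x)"
      unfolding F_def K_def using k
      by (intro DERIV_add DERIV_diff DERIV_cmult DERIV_cdivide d\<Theta>) auto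
    moreover have "c * (L x ^ (k - 1) * K) - 2 * (L x ^ k * K) + L x ^ (k + 1) * K / c =
        L x ^ (k - 1) * K * ((c - L x)\<^sup>2 / c)"
    proof -
      obtain m where "k = Suc m" using k by (cases k) auto
      then show ?thesis using c by (simp add: field_simps power2_eq_square)
    qed
    moreover have "0 \<le> \<dots>"
      using Lpos[of x] CS[of x] c by (auto simp: K_def intro!: mult_nonneg_nonneg divide_nonneg_nonneg)
    ultimately show "\<exists>y. (F has_real_derivative y) (at x) \<and> 0 \<le> y" by metis
  qed
  moreover have "(F \<longlongrightarrow> 0) at_top"
  proof -
    have "(F \<longlongrightarrow> c * 0 - 2 * 0 + 0 / c) at_top"
      unfolding F_def using k c by (intro tendsto_intros \<Theta>_lim) auto
    then show ?thesis by simp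
  qed
  ultimately have "F 0 \<le> 0"
    by (intro tendsto_lowerbound[of F 0 at_top]) (auto intro!: eventually_at_top_linorderI[of 0])
  moreover have "\<Theta> j 0 = - d j" for j
    by (simp add: \<Theta>_def d_def L_def N_def w(2))
  ultimately show ?thesis by (simp add: F_def)
qed

section \<open>Moments of finitely supported laws\<close>

text \<open>Unlike the product form, the linear form survives integration. The optimal choice is c =
  v/u; if u = 0, a large c, namely (z + 1)/v, contradicts v > 0.\<close>

lemma square_le_mult_if_linear:
  fixes u v z :: real
  assumes "0 \<le> u" "0 \<le> v" "0 \<le> z" and lin: "\<And>c. 0 < c \<Longrightarrow> 2 * v \<le> c * u + z / c"
  shows "v\<^sup>2 \<le> u * z"
proof (cases "v = 0")
  case False
  then have v: "0 < v" using assms(2) by simp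
  show ?thesis
  proof (cases "u = 0")
    case True
    have "2 * v \<le> z / ((z + 1) / v)" using lin[of "(z + 1) / v"] v True assms(3) by simp
    also have "\<dots> = (z / (z + 1)) * v" by simp
    also have "\<dots> \<le> 1 * v" using v assms(3) by (intro mult_right_mono) auto
    finally show ?thesis using v by simp
  next
    case False
    then have u: "0 < u" using assms(1) by simp
    have "2 * v \<le> (v / u) * u + z / (v / u)" using lin[of "v / u"] u v by simp
    then have "v \<le> z * u / v" using u by simp
    then show ?thesis using v by (simp add: field_simps power2_eq_square)
  qed
qed (use assms in auto)

text \<open>Substituting x r for r pulls out x^a. The constant is pi/sin(pi a), but only its
  finiteness and positivity matter: the integrand at x = 1 is dominated by r^(a - 1) near 0 and by
  r^(a - 2) near infinity.\<close>

lemma stieltjes_kernel: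
  fixes a :: real
  assumes "0 < a" "a < 1"
  shows "\<exists>C>0. \<forall>x\<ge>0. (\<integral>\<^sup>+ r. ennreal (indicator {0<..} r * r powr (a - 1) * (x / (x + r))) \<partial>lborel)
    = ennreal (C * x powr a)"
proof -
  define f where "f x r = indicator {0<..} r * r powr (a - 1) * (x / (x + r))" for x r :: real
  have f_nonneg: "0 \<le> f x r" if "0 \<le> x" for x r
    using that by (auto simp: f_def indicator_def)
  have [measurable]: "f x \<in> borel_measurable borel" for x
    unfolding f_def[abs_def] by measurable
  define J where "J = (\<integral>\<^sup>+ r. ennreal (f 1 r) \<partial>lborel)"
  have "f 1 r \<le> indicator {0..1} r * r powr (a - 1) + indicator {1..} r * r powr (a - 2)" for r
  proof (cases "0 < r")
    case True
    have "r powr (a - 1) * (1 / (1 + r)) \<le> r powr (a - 1) * 1" using True by (intro mult_left_mono) auto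
    moreover have "r powr (a - 1) * (1 / (1 + r)) \<le> r powr (a - 1) * (1 / r)"
      using True by (intro mult_left_mono) (auto simp: field_simps)
    moreover have "r powr (a - 1) * (1 / r) = r powr (a - 2)"
      using True powr_diff[of r "a - 1" 1] by simp
    ultimately show ?thesis using True by (auto simp: f_def indicator_def)
  qed (auto simp: f_def indicator_def)
  then have "J \<le> (\<integral>\<^sup>+ r. ennreal (indicator {0..1} r * r powr (a - 1)) + ennreal (indicator {1..} r * r powr (a - 2)) \<partial>lborel)"
    unfolding J_def by (intro nn_integral_mono) (simp add: ennreal_plus[symmetric] del: ennreal_plus)
  also have "\<dots> = (\<integral>\<^sup>+ r. ennreal (indicator {0..1} r * r powr (a - 1)) \<partial>lborel) +
      (\<integral>\<^sup>+ r. ennreal (indicator {1..} r * r powr (a - 2)) \<partial>lborel)"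
    by (rule nn_integral_add) auto
  also have "(\<integral>\<^sup>+ r. ennreal (indicator {0..1} r * r powr (a - 1)) \<partial>lborel) = ennreal (1 powr (a - 1 + 1) / (a - 1 + 1))"
    using assms by (intro nn_integral_has_integral_lebesgue has_integral_powr_from_0) auto
  also have "(\<integral>\<^sup>+ r. ennreal (indicator {1..} r * r powr (a - 2)) \<partial>lborel) = ennreal (- (1 powr (a - 2 + 1)) / (a - 2 + 1))"
    using assms by (intro nn_integral_has_integral_lebesgue has_integral_powr_to_inf) auto
  finally have "J < \<infinity>" by (simp add: le_less_trans ennreal_plus[symmetric] del: ennreal_plus)
  moreover have "0 < J"
  proof -
    have "0 < ennreal (2 powr (a - 1) / 3)" by simp
    also have "\<dots> = (\<integral>\<^sup>+ r. ennreal (2 powr (a - 1) / 3) * indicator {1..2} (r::real) \<partial>lborel)"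
      by (simp add: nn_integral_cmult_indicator)
    also have "\<dots> \<le> J"
      unfolding J_def
    proof (rule nn_integral_mono)
      fix r :: real
      have "2 powr (a - 1) / 3 \<le> r powr (a - 1) * (1 / (1 + r))" if "1 \<le> r" "r \<le> 2"
      proof -
        have "2 powr (a - 1) \<le> r powr (a - 1)" using that assms by (intro powr_mono2') auto
        moreover have "1 / 3 \<le> 1 / (1 + r)" using that by (simp add: field_simps)
        ultimately have "2 powr (a - 1) * (1 / 3) \<le> r powr (a - 1) * (1 / (1 + r))"
          by (intro mult_mono) auto
        then show ?thesis by simp
      qed
      then show "ennreal (2 powr (a - 1) / 3) * indicator {1..2} r \<le> ennreal (f 1 r)"
        by (auto simp: f_def indicator_def intro!: ennreal_leI)
    qed
    finally show ?thesis .
  qed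
  ultimately obtain C where C: "J = ennreal C" "0 < C"
    by (cases J rule: ennreal_cases) (auto simp: top_unique)
  have "(\<integral>\<^sup>+ r. ennreal (f x r) \<partial>lborel) = ennreal (C * x powr a)" if "0 \<le> x" for x
  proof (cases "x = 0")
    case False
    then have x: "0 < x" using that by simp
    have "(\<integral>\<^sup>+ r. ennreal (f x r) \<partial>lborel) = \<bar>x\<bar> * (\<integral>\<^sup>+ r. ennreal (f x (0 + x * r)) \<partial>lborel)"
      using x by (intro nn_integral_real_affine) auto
    also have "(\<lambda>r. ennreal (f x (0 + x * r))) = (\<lambda>r. ennreal (x powr (a - 1)) * ennreal (f 1 r))"
    proof
      fix r
      have "f x (0 + x * r) = x powr (a - 1) * f 1 r"
      proof (cases "0 < r")
        case True
        have "x + x * r = x * (1 + r)" by (simp add: algebra_simps)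
        then have "x / (x + x * r) = 1 / (1 + r)" using x by simp
        then show ?thesis using x True by (simp add: f_def powr_mult)
      qed (use x in \<open>auto simp: f_def indicator_def zero_less_mult_iff\<close>)
      then show "ennreal (f x (0 + x * r)) = ennreal (x powr (a - 1)) * ennreal (f 1 r)"
        by (simp add: ennreal_mult f_nonneg)
    qed
    also have "(\<integral>\<^sup>+ r. ennreal (x powr (a - 1)) * ennreal (f 1 r) \<partial>lborel) = ennreal (x powr (a - 1)) * J"
      unfolding J_def by (rule nn_integral_cmult) auto
    also have "ennreal \<bar>x\<bar> * (ennreal (x powr (a - 1)) * J) = ennreal (C * (x * x powr (a - 1)))"
      using x C by (simp add: ennreal_mult[symmetric] mult_ac)
    also have "x * x powr (a - 1) = x powr a"
      using x powr_add[of x 1 "a - 1"] by simp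
    finally show ?thesis .
  qed (simp add: f_def)
  then show ?thesis using C(2) unfolding f_def by (intro exI[of _ C]) auto
qed

text \<open>Finitely supported laws have finite moments, so real values suffice for positive
  exponents, where \<open>0 powr p = 0\<close> is the intended value.\<close>

definition fin_moment :: "(real \<Rightarrow> real) \<Rightarrow> real set \<Rightarrow> real \<Rightarrow> nat \<Rightarrow> real" where
  "fin_moment w S p k = fin_exp w S k (\<lambda>s. (s / real k) powr p)"

section \<open>Exponents below 2 through Stieltjes integrals\<close>

context
  fixes S :: "real set" and w :: "real \<Rightarrow> real"
  assumes fin: "finite S" and S0: "\<And>y. y \<in> S \<Longrightarrow> 0 \<le> y" and w0: "\<And>y. y \<in> S \<Longrightarrow> 0 \<le> w y"
begin

lemma fin_moment_nonneg: "0 \<le> fin_moment w S p k"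
  unfolding fin_moment_def by (rule fin_exp_nonneg) (auto simp: S0 w0)

lemma fin_moment_shift:
  assumes "1 \<le> k"
  shows "fin_exp w S k (\<lambda>s. (s / real k + t) powr p) = fin_moment (\<lambda>y. w (y - t)) ((\<lambda>y. y + t) ` S) p k"
  unfolding fin_moment_def fin_exp_shift[symmetric] using assms by (simp add: add_divide_distrib)

text \<open>This is \<open>fin_exp_inverse_mean\<close> for the law of X + r, whose atoms are at
  least r > 0 even if X has an atom at 0.\<close>

lemma fin_exp_inverse_shifted_mean:
  assumes w1: "(\<Sum>y\<in>S. w y) = 1" and k: "2 \<le> k" and c: "0 < (c::real)" and r: "0 < r"
  defines "d \<equiv> \<lambda>k. fin_exp w S k (\<lambda>s. 1 / (s / real k + r)) - 1 / ((\<Sum>y\<in>S. w y * y) + r)"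
  shows "2 * d k \<le> c * d (k - 1) + d (k + 1) / c"
proof -
  define w' where "w' y = w (y - r)" for y
  define S' where "S' = (\<lambda>y. y + r) ` S"
  have inj: "inj_on (\<lambda>y. y + r) S" by (auto simp: inj_on_def)
  have w'1: "(\<Sum>y\<in>S'. w' y) = 1"
    unfolding S'_def w'_def using w1 by (simp add: sum.reindex[OF inj])
  have mean: "(\<Sum>y\<in>S'. w' y * y) = (\<Sum>y\<in>S. w y * y) + r"
    unfolding S'_def w'_def using w1
    by (simp add: sum.reindex[OF inj] distrib_left sum.distrib sum_distrib_right[symmetric])
  have d: "d j = fin_exp w' S' j (\<lambda>s. real j / s) - 1 / (\<Sum>y\<in>S'. w' y * y)" if "1 \<le> j" for j
  proof -
    have "fin_exp w' S' j (\<lambda>s. real j / s) = fin_exp w S j (\<lambda>s. real j / (s + real j * r))"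
      unfolding w'_def S'_def fin_exp_shift[symmetric] ..
    also have "\<dots> = fin_exp w S j (\<lambda>s. 1 / (s / real j + r))"
    proof (rule fin_exp_cong[where a = 0, OF S0])
      fix s :: real
      have "s / real j + r = (s + real j * r) / real j" using that by (simp add: add_divide_distrib)
      then show "real j / (s + real j * r) = 1 / (s / real j + r)" by simp
    qed auto
    finally show ?thesis by (simp add: d_def mean)
  qed
  have "2 * (fin_exp w' S' k (\<lambda>s. real k / s) - 1 / (\<Sum>y\<in>S'. w' y * y)) \<le>
      c * (fin_exp w' S' (k - 1) (\<lambda>s. real (k - 1) / s) - 1 / (\<Sum>y\<in>S'. w' y * y)) +
      (fin_exp w' S' (k + 1) (\<lambda>s. real (k + 1) / s) - 1 / (\<Sum>y\<in>S'. w' y * y)) / c"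
    by (rule fin_exp_inverse_mean[OF _ _ _ w'1 k c])
      (use fin S0 w0 r in \<open>force simp: S'_def w'_def\<close>)+
  then show ?thesis using k by (simp add: d)
qed

lemma fin_exp_mean:
  assumes "(\<Sum>y\<in>S. w y) = 1" "1 \<le> k"
  shows "fin_exp w S k (\<lambda>s. s / real k) = (\<Sum>y\<in>S. w y * y)"
  using fin_exp_cmult[of w S k "1 / real k" "\<lambda>s. s"] fin_exp_id[OF assms(1), of k] assms(2) by simp

text \<open>The kernel identity is multiplied by x^q and summed over the law. Taking q = 0 covers
  exponents in (0, 1), and q = 1 those in (1, 2).\<close>

lemma fin_moment_kernel:
  assumes a: "0 < a" "a < 1" and C: "\<And>x. 0 \<le> x \<Longrightarrow>
      (\<integral>\<^sup>+ r. ennreal (indicator {0<..} r * r powr (a - 1) * (x / (x + r))) \<partial>lborel) = ennreal (C * x powr a)"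
    "0 < C" and q: "0 \<le> q"
  shows "(\<integral>\<^sup>+ r. ennreal (indicator {0<..} r * r powr (a - 1) *
      fin_exp w S k (\<lambda>s. (s / real k) powr q * (s / real k / (s / real k + r)))) \<partial>lborel) =
      ennreal (C * fin_moment w S (a + q) k)" (is ?eq)
    and "(\<lambda>r. indicator {0<..} r * r powr (a - 1) *
      fin_exp w S k (\<lambda>s. (s / real k) powr q * (s / real k / (s / real k + r)))) \<in> borel_measurable lborel" (is ?meas)
proof -
  define G where "G r s = indicator {0<..} r * r powr (a - 1) *
      ((s / real k) powr q * (s / real k / (s / real k + r)))" for r s :: real
  have "(\<integral>\<^sup>+ r. ennreal (G r s) \<partial>lborel) = ennreal (C * (s / real k) powr (a + q))" if "0 \<le> s" for s
  proof -
    define x where "x = s / real k"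
    have x: "0 \<le> x" using that by (simp add: x_def)
    have "(\<integral>\<^sup>+ r. ennreal (G r s) \<partial>lborel) =
       (\<integral>\<^sup>+ r. ennreal (x powr q) * ennreal (indicator {0<..} r * r powr (a - 1) * (x / (x + r))) \<partial>lborel)"
      using x by (intro nn_integral_cong) (auto simp: G_def x_def[symmetric] ennreal_mult[symmetric] mult_ac indicator_def)
    also have "\<dots> = ennreal (x powr q) * ennreal (C * x powr a)"
      unfolding C(1)[OF x, symmetric] by (rule nn_integral_cmult) auto
    also have "\<dots> = ennreal (C * x powr (a + q))"
      using C(2) by (simp add: ennreal_mult[symmetric] powr_add mult_ac)
    finally show ?thesis by (simp add: x_def)
  qed
  then have *: "(\<lambda>r. fin_exp w S k (G r)) \<in> borel_measurable lborel \<and>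
     (\<integral>\<^sup>+r. ennreal (fin_exp w S k (G r)) \<partial>lborel) = ennreal (fin_exp w S k (\<lambda>s. C * (s / real k) powr (a + q)))"
    using C(2) by (intro nn_integral_fin_exp[OF fin w0 S0]) (auto simp: G_def indicator_def)
  show ?eq ?meas
    using * unfolding G_def[abs_def] fin_exp_cmult fin_moment_def by blast+
qed

text \<open>In x/(x + r) = 1 - r/(x + r) only the last term depends on k after taking expectations,
  and the defect inequality with c = 1 makes E[1/(x + r)] convex in k. Integrating against r^(p - 1)
  keeps the reversed inequality.\<close>

lemma fin_moment_concave:
  assumes p: "0 < p" "p < 1" and w1: "(\<Sum>y\<in>S. w y) = 1" and k: "2 \<le> k"
  shows "fin_moment w S p (k - 1) + fin_moment w S p (k + 1) \<le> 2 * fin_moment w S p k"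
proof -
  obtain C where C: "0 < C" "\<And>x. 0 \<le> x \<Longrightarrow>
      (\<integral>\<^sup>+ r. ennreal (indicator {0<..} r * r powr (p - 1) * (x / (x + r))) \<partial>lborel) = ennreal (C * x powr p)"
    using stieltjes_kernel[OF p] by blast
  define R where "R j r = fin_exp w S j (\<lambda>s. (s / real j) powr 0 * (s / real j / (s / real j + r)))" for j r
  define Q where "Q j r = indicator {0<..} r * r powr (p - 1) * R j r" for j and r :: real
  have int: "(\<integral>\<^sup>+ r. ennreal (Q j r) \<partial>lborel) = ennreal (C * fin_moment w S p j)" for j
    using fin_moment_kernel(1)[OF p C(2,1) order_refl, of j] by (simp add: Q_def R_def)
  have [measurable]: "Q j \<in> borel_measurable lborel" for j
    using fin_moment_kernel(2)[OF p C(2,1) order_refl, of j] by (simp add: Q_def[abs_def] R_def)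
  have Q_nonneg: "0 \<le> Q j r" for j r
    unfolding Q_def R_def by (auto simp: indicator_def S0 w0 intro!: mult_nonneg_nonneg fin_exp_nonneg)
  have R: "R j r = 1 - r * fin_exp w S j (\<lambda>s. 1 / (s / real j + r))" if "0 < r" "1 \<le> j" for j r
  proof -
    have "R j r = fin_exp w S j (\<lambda>s. 1 + (- r) * (1 / (s / real j + r)))"
      unfolding R_def
    proof (rule fin_exp_cong[where a = 0, OF S0])
      fix s :: real assume "real j * 0 \<le> s"
      then have x: "0 \<le> s / real j" by simp
      have "x / (x + r) = 1 + (- r) * (1 / (x + r))" if "0 \<le> x" for x
        using that \<open>0 < r\<close> by (simp add: divide_simps)
      \<comment> \<open>Although \<open>0 powr 0 = 0\<close>, nothing is lost at x = 0: there x/(x +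
        r) and 1 - r/(x + r) vanish as well.\<close>
      from this[OF x] show "(s / real j) powr 0 * (s / real j / (s / real j + r)) = 1 + (- r) * (1 / (s / real j + r))"
        by (cases "s / real j = 0") auto
    qed auto
    then show ?thesis by (simp only: fin_exp_add fin_exp_cmult fin_exp_const w1) simp
  qed
  have "Q (k - 1) r + Q (k + 1) r \<le> 2 * Q k r" for r
  proof (cases "0 < r")
    case True
    have "R (k - 1) r + R (k + 1) r \<le> 2 * R k r"
      using mult_left_mono[OF fin_exp_inverse_shifted_mean[OF w1 k zero_less_one True], of r] True k
      by (simp add: R algebra_simps)
    then show ?thesis using True mult_left_mono[of "R (k - 1) r + R (k + 1) r" "2 * R k r" "r powr (p - 1)"]
      by (simp add: Q_def algebra_simps)
  qed (simp add: Q_def)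
  then have "(\<integral>\<^sup>+ r. ennreal (Q (k - 1) r) + ennreal (Q (k + 1) r) \<partial>lborel) \<le> (\<integral>\<^sup>+ r. 2 * ennreal (Q k r) \<partial>lborel)"
  proof (intro nn_integral_mono)
    fix r assume le: "\<And>r. Q (k - 1) r + Q (k + 1) r \<le> 2 * Q k r"
    have "ennreal (Q (k - 1) r) + ennreal (Q (k + 1) r) = ennreal (Q (k - 1) r + Q (k + 1) r)"
      by (simp add: Q_nonneg)
    also have "\<dots> \<le> ennreal (2 * Q k r)" by (rule ennreal_leI[OF le])
    finally show "ennreal (Q (k - 1) r) + ennreal (Q (k + 1) r) \<le> 2 * ennreal (Q k r)"
      by (simp add: ennreal_mult' Q_nonneg)
  qed
  then have "ennreal (C * fin_moment w S p (k - 1)) + ennreal (C * fin_moment w S p (k + 1)) \<le> 2 * ennreal (C * fin_moment w S p k)"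
    by (simp add: nn_integral_add nn_integral_cmult int)
  also have "2 * ennreal (C * fin_moment w S p k) = ennreal (2 * (C * fin_moment w S p k))"
    by (simp add: ennreal_mult')
  finally have "C * fin_moment w S p (k - 1) + C * fin_moment w S p (k + 1) \<le> 2 * (C * fin_moment w S p k)"
    using C(1) fin_moment_nonneg by (simp add: ennreal_plus[symmetric] del: ennreal_plus)
  then have "C * (fin_moment w S p (k - 1) + fin_moment w S p (k + 1)) \<le> C * (2 * fin_moment w S p k)"
    by (simp add: algebra_simps)
  then show ?thesis using C(1) by simp
qed

text \<open>With \<mu> the mean, E[x^2/(x + r)] equals \<mu>^2/(\<mu> + r) plus r^2 times the defect
  E[1/(x + r)] - 1/(\<mu> + r). The first part is a nonnegative constant in k and satisfies the
  linear inequality because c + 1/c >= 2; the defect satisfies it by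
  \<open>fin_exp_inverse_shifted_mean\<close>. The sum is then integrated over r.\<close>

lemma fin_moment_log_convex_below_2:
  assumes p: "1 < p" "p < 2" and w1: "(\<Sum>y\<in>S. w y) = 1" and k: "2 \<le> k"
  shows "(fin_moment w S p k)\<^sup>2 \<le> fin_moment w S p (k - 1) * fin_moment w S p (k + 1)"
proof (intro square_le_mult_if_linear fin_moment_nonneg)
  fix c :: real assume c: "0 < c"
  define a where "a = p - 1"
  have a: "0 < a" "a < 1" "a + 1 = p" using p by (auto simp: a_def)
  obtain C where C: "0 < C" "\<And>x. 0 \<le> x \<Longrightarrow>
      (\<integral>\<^sup>+ r. ennreal (indicator {0<..} r * r powr (a - 1) * (x / (x + r))) \<partial>lborel) = ennreal (C * x powr a)"
    using stieltjes_kernel[OF a(1,2)] by blast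
  define R where "R j r = fin_exp w S j (\<lambda>s. (s / real j) powr 1 * (s / real j / (s / real j + r)))" for j r
  define Q where "Q j r = indicator {0<..} r * r powr (a - 1) * R j r" for j and r :: real
  have int: "(\<integral>\<^sup>+ r. ennreal (Q j r) \<partial>lborel) = ennreal (C * fin_moment w S p j)" for j
    using fin_moment_kernel(1)[OF a(1,2) C(2,1) zero_le_one, of j] by (simp add: Q_def R_def a(3))
  have [measurable]: "Q j \<in> borel_measurable lborel" for j
    using fin_moment_kernel(2)[OF a(1,2) C(2,1) zero_le_one, of j] by (simp add: Q_def[abs_def] R_def)
  have Q_nonneg: "0 \<le> Q j r" for j r
    unfolding Q_def R_def by (auto simp: indicator_def S0 w0 intro!: mult_nonneg_nonneg fin_exp_nonneg)
  define \<mu> where "\<mu> = (\<Sum>y\<in>S. w y * y)"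
  have \<mu>: "0 \<le> \<mu>" unfolding \<mu>_def by (intro sum_nonneg) (auto simp: S0 w0)
  have R: "R j r = \<mu>\<^sup>2 / (\<mu> + r) + r\<^sup>2 * (fin_exp w S j (\<lambda>s. 1 / (s / real j + r)) - 1 / (\<mu> + r))"
    if r: "0 < r" and j: "1 \<le> j" for j r
  proof -
    have "R j r = fin_exp w S j (\<lambda>s. s / real j + (- r + r\<^sup>2 * (1 / (s / real j + r))))"
      unfolding R_def
    proof (rule fin_exp_cong[where a = 0, OF S0])
      fix s :: real assume "real j * 0 \<le> s"
      then have x: "0 \<le> s / real j" by simp
      have "x * (x / (x + r)) = x + (- r + r\<^sup>2 * (1 / (x + r)))" if "0 \<le> x" for x
        using that r by (simp add: field_simps power2_eq_square)
      from this[OF x] show "(s / real j) powr 1 * (s / real j / (s / real j + r)) =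
          s / real j + (- r + r\<^sup>2 * (1 / (s / real j + r)))"
        by (simp only: powr_one[OF x])
    qed auto
    also have "\<dots> = \<mu> + (- r + r\<^sup>2 * fin_exp w S j (\<lambda>s. 1 / (s / real j + r)))"
      by (simp only: fin_exp_add fin_exp_cmult fin_exp_const w1 fin_exp_mean[OF w1 j] \<mu>_def) simp
    also have "\<mu> - r = (\<mu>\<^sup>2 - r\<^sup>2) / (\<mu> + r)"
      using \<mu> r by (simp add: power2_eq_square square_diff_square_factored)
    then have "\<mu> - r = \<mu>\<^sup>2 / (\<mu> + r) - r\<^sup>2 * (1 / (\<mu> + r))"
      by (simp add: diff_divide_distrib)
    then have "\<mu> + (- r + r\<^sup>2 * F) = \<mu>\<^sup>2 / (\<mu> + r) + r\<^sup>2 * (F - 1 / (\<mu> + r))" for F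
      by (simp add: algebra_simps)
    finally show ?thesis .
  qed
  have "2 * Q k r \<le> c * Q (k - 1) r + 1 / c * Q (k + 1) r" for r
  proof (cases "0 < r")
    case True
    have "(c - 1)\<^sup>2 / c = c + 1 / c - 2" using c by (simp add: field_simps power2_eq_square)
    then have c2: "2 \<le> c + 1 / c" using c zero_le_power2[of "c - 1"]
      by (smt (verit) divide_nonneg_pos)
    have "2 * R k r \<le> c * R (k - 1) r + 1 / c * R (k + 1) r"
    proof -
      define D where "D j = fin_exp w S j (\<lambda>s. 1 / (s / real j + r)) - 1 / (\<mu> + r)" for j
      define A where "A = \<mu>\<^sup>2 / (\<mu> + r)"
      have A: "0 \<le> A" using \<mu> True by (simp add: A_def)
      have "2 * D k \<le> c * D (k - 1) + D (k + 1) / c"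
        using fin_exp_inverse_shifted_mean[OF w1 k c True] by (simp add: D_def \<mu>_def)
      then have "r\<^sup>2 * (2 * D k) \<le> r\<^sup>2 * (c * D (k - 1) + D (k + 1) / c)"
        by (rule mult_left_mono) simp
      moreover have "2 * A \<le> (c + 1 / c) * A" using c2 A by (rule mult_right_mono)
      moreover have "R j r = A + r\<^sup>2 * D j" if "1 \<le> j" for j
        using R[OF True that] by (simp add: A_def D_def)
      ultimately show ?thesis using k by (simp add: algebra_simps)
    qed
    then have "r powr (a - 1) * (2 * R k r) \<le> r powr (a - 1) * (c * R (k - 1) r + 1 / c * R (k + 1) r)"
      by (rule mult_left_mono) simp
    then show ?thesis using True by (simp add: Q_def algebra_simps)
  qed (simp add: Q_def)
  then have "(\<integral>\<^sup>+ r. 2 * ennreal (Q k r) \<partial>lborel) \<le>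
     (\<integral>\<^sup>+ r. ennreal c * ennreal (Q (k - 1) r) + ennreal (1 / c) * ennreal (Q (k + 1) r) \<partial>lborel)"
  proof (intro nn_integral_mono)
    fix r assume le: "\<And>r. 2 * Q k r \<le> c * Q (k - 1) r + 1 / c * Q (k + 1) r"
    have "2 * ennreal (Q k r) = ennreal (2 * Q k r)" by (simp add: ennreal_mult')
    also have "\<dots> \<le> ennreal (c * Q (k - 1) r + 1 / c * Q (k + 1) r)" by (rule ennreal_leI[OF le])
    also have "\<dots> = ennreal c * ennreal (Q (k - 1) r) + ennreal (1 / c) * ennreal (Q (k + 1) r)"
      using c Q_nonneg by (subst ennreal_plus) (auto simp: ennreal_mult'[symmetric] ennreal_mult[symmetric])
    finally show "2 * ennreal (Q k r) \<le> ennreal c * ennreal (Q (k - 1) r) + ennreal (1 / c) * ennreal (Q (k + 1) r)" .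
  qed
  then have "2 * ennreal (C * fin_moment w S p k) \<le>
      ennreal c * ennreal (C * fin_moment w S p (k - 1)) + ennreal (1 / c) * ennreal (C * fin_moment w S p (k + 1))"
    by (simp add: nn_integral_add nn_integral_cmult int)
  also have "\<dots> = ennreal (c * (C * fin_moment w S p (k - 1)) + 1 / c * (C * fin_moment w S p (k + 1)))"
    using c C(1) fin_moment_nonneg by (subst ennreal_plus) (auto simp: ennreal_mult[symmetric])
  also have "2 * ennreal (C * fin_moment w S p k) = ennreal (2 * (C * fin_moment w S p k))"
    by (simp add: ennreal_mult')
  finally have "2 * (C * fin_moment w S p k) \<le> c * (C * fin_moment w S p (k - 1)) + 1 / c * (C * fin_moment w S p (k + 1))"
    using c C(1) fin_moment_nonneg by (subst (asm) ennreal_le_iff) auto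
  then have "C * (2 * fin_moment w S p k) \<le> C * (c * fin_moment w S p (k - 1) + fin_moment w S p (k + 1) / c)"
    by (simp add: algebra_simps)
  then show "2 * fin_moment w S p k \<le> c * fin_moment w S p (k - 1) + fin_moment w S p (k + 1) / c"
    using C(1) by simp
qed

lemma fin_moment_1:
  assumes "(\<Sum>y\<in>S. w y) = 1" "1 \<le> k"
  shows "fin_moment w S 1 k = (\<Sum>y\<in>S. w y * y)"
proof -
  have "fin_moment w S 1 k = fin_exp w S k (\<lambda>s. s / real k)"
    unfolding fin_moment_def by (rule fin_exp_cong[where a = 0, OF S0]) auto
  then show ?thesis using fin_exp_mean[OF assms] by simp
qed

end

text \<open>A total mass W multiplies the j-th moment by W^j, which cancels because (k - 1) + (k +
  1) = 2 k. Masses other than 1 have to be allowed since removing an atom does not preserve the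
  mass.\<close>

lemma fin_moment_log_convex_base:
  assumes fin: "finite S" and S0: "\<And>y. y \<in> S \<Longrightarrow> 0 \<le> y" and w0: "\<And>y. y \<in> S \<Longrightarrow> 0 \<le> w y"
    and p: "1 \<le> p" "p < 2" and k: "2 \<le> k"
  shows "(fin_moment w S p k)\<^sup>2 \<le> fin_moment w S p (k - 1) * fin_moment w S p (k + 1)"
proof -
  define W where "W = (\<Sum>y\<in>S. w y)"
  show ?thesis
  proof (cases "W = 0")
    case True
    then have "\<And>y. y \<in> S \<Longrightarrow> w y = 0"
      using sum_nonneg_eq_0_iff[of S w] fin w0 by (auto simp: W_def)
    moreover obtain j where "k = Suc j" using k by (cases k) auto
    ultimately show ?thesis by (simp add: fin_moment_def)
  next
    case False
    have "0 \<le> W" unfolding W_def by (intro sum_nonneg w0)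
    with False have W: "0 < W" by simp
    define v where "v y = (1 / W) * w y" for y
    have v: "\<And>y. y \<in> S \<Longrightarrow> 0 \<le> v y" using w0 W by (simp add: v_def)
    have v1: "(\<Sum>y\<in>S. v y) = 1"
      using W unfolding v_def sum_distrib_left[symmetric] W_def[symmetric] by simp
    have v_lc: "(fin_moment v S p k)\<^sup>2 \<le> fin_moment v S p (k - 1) * fin_moment v S p (k + 1)"
    proof (cases "p = 1")
      case True
      then show ?thesis using k fin_moment_1[OF fin S0 v v1] by (simp add: power2_eq_square)
    next
      case False
      then show ?thesis using fin_moment_log_convex_below_2[OF fin S0 v _ p(2) v1 k] p by simp
    qed
    have wv: "fin_moment w S p j = W ^ j * fin_moment v S p j" for j
    proof -
      have "w = (\<lambda>y. W * v y)" using W by (simp add: v_def)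
      then have "fin_moment w S p j = fin_moment (\<lambda>y. W * v y) S p j" by simp
      then show ?thesis by (simp only: fin_moment_def fin_exp_scale_weight)
    qed
    have "k - 1 + (k + 1) = k + k" using k by simp
    then have "W ^ (k - 1) * W ^ (k + 1) = W ^ k * W ^ k" by (simp only: power_add[symmetric])
    then have "fin_moment w S p (k - 1) * fin_moment w S p (k + 1) =
        W ^ k * W ^ k * (fin_moment v S p (k - 1) * fin_moment v S p (k + 1))"
      unfolding wv by (metis mult.assoc mult.left_commute)
    moreover have "(fin_moment w S p k)\<^sup>2 = W ^ k * W ^ k * (fin_moment v S p k)\<^sup>2"
      unfolding wv by (simp add: power2_eq_square)
    ultimately show ?thesis using v_lc W by (simp add: mult_left_mono)
  qed
qed

section \<open>From exponent p - 1 to exponent p\<close>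

lemma fin_exp_restrict_support:
  assumes "finite S"
  shows "fin_exp w S k g = fin_exp w {y \<in> S. w y \<noteq> 0} k g"
proof (induction k arbitrary: g)
  case (Suc k)
  have "fin_exp w S (Suc k) g = (\<Sum>y\<in>{y \<in> S. w y \<noteq> 0}. w y * fin_exp w S k (\<lambda>s. g (s + y)))"
    unfolding fin_exp.simps using assms by (intro sum.mono_neutral_right) auto
  then show ?case using Suc by simp
qed simp

text \<open>For a law with an atom at \<open>0\<close> the moments are the binomial transform of those of the
  law without that atom.\<close>
lemma fin_moment_thinning:
  assumes fin: "finite S" and S0: "0 \<in> S" and pos: "\<And>y. y \<in> S \<Longrightarrow> y \<noteq> 0 \<Longrightarrow> 0 < y"
    and w: "\<And>y. y \<in> S \<Longrightarrow> 0 < w y" and ne: "S - {0} \<noteq> {}" and p: "1 \<le> p"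
    and lc: "\<And>n. 2 \<le> n \<Longrightarrow> (fin_moment w (S - {0}) p n)\<^sup>2 \<le>
      fin_moment w (S - {0}) p (n - 1) * fin_moment w (S - {0}) p (n + 1)"
  shows "2 \<le> k \<Longrightarrow> (fin_moment w S p k)\<^sup>2 \<le> fin_moment w S p (k - 1) * fin_moment w S p (k + 1)"
    and "1 \<le> k \<Longrightarrow> 0 < fin_moment w S p k"
proof -
  define T where "T = S - {0}"
  have T: "finite T" "T \<noteq> {}" "\<And>y. y \<in> T \<Longrightarrow> 0 < y" "\<And>y. y \<in> T \<Longrightarrow> 0 < w y"
    using fin ne pos w by (auto simp: T_def)
  define a where "a = Min T"
  have a: "0 < a" "\<And>y. y \<in> T \<Longrightarrow> a \<le> y"
    unfolding a_def using T by auto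
  define g where "g n = fin_exp w T n (\<lambda>s. s powr p)" for n
  have norm: "fin_exp w U n (\<lambda>s. (s / real n) powr p) = fin_exp w U n (\<lambda>s. s powr p) / real n powr p"
    if "\<And>y. y \<in> U \<Longrightarrow> 0 \<le> y" for U n
  proof -
    have "fin_exp w U n (\<lambda>s. (s / real n) powr p) = fin_exp w U n (\<lambda>s. (1 / real n powr p) * s powr p)"
      using that by (intro fin_exp_cong[where a = 0]) (auto simp: powr_divide)
    then show ?thesis by (simp only: fin_exp_cmult) simp
  qed
  have g: "fin_moment w T p n = g n / real n powr p" for n
    unfolding fin_moment_def g_def using T(3) by (intro norm) (simp add: less_imp_le)
  have g0: "g 0 = 0" using p by (simp add: g_def)
  have gpos: "0 < g n" if "1 \<le> n" for n
  proof -
    \<comment> \<open>Without the atom 0 every sum of n atoms is at least n a > 0, so a positive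
      constant bounds the integrand below.\<close>
    have "0 < (\<Sum>y\<in>T. w y) ^ n * (real n * a) powr p"
      using T a that by (intro mult_pos_pos zero_less_power sum_pos) auto
    also have "\<dots> = fin_exp w T n (\<lambda>_. (real n * a) powr p)"
      by (simp add: fin_exp_const)
    also have "\<dots> \<le> g n"
      unfolding g_def using T(4) p a that by (intro fin_exp_mono[where a = a] powr_mono2) (auto simp: less_imp_le)
    finally show ?thesis .
  qed
  define A where "A k = (\<Sum>n\<le>k. real (k choose n) * w 0 ^ (k - n) * g n)" for k
  have A: "fin_moment w S p k = A k / real k powr p" for k
    unfolding fin_moment_def A_def g_def T_def fin_exp_binomial[OF fin S0, symmetric]
    using pos by (intro norm) force
  have w0: "0 < w 0" using w S0 by simp
  show "(fin_moment w S p k)\<^sup>2 \<le> fin_moment w S p (k - 1) * fin_moment w S p (k + 1)" if "2 \<le> k"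
    unfolding A A_def
    by (rule binomial_transform_log_convex[where g = g, OF p less_imp_le[OF w0] g0 gpos _ that])
      (use lc in \<open>simp_all add: T_def[symmetric] g\<close>)
  show "0 < fin_moment w S p k" if "1 \<le> k"
  proof -
    have "0 \<le> g n" for n using g0 gpos[of n] by (cases n) auto
    then have "0 < A k"
      unfolding A_def using w0 gpos[OF that] by (intro sum_pos2[of _ k]) auto
    then show ?thesis using that by (simp add: A)
  qed
qed

text \<open>Apply \<open>log_convexity_propagates\<close> to the moments of X + t as functions of t:
  the p-th one has derivative p times the (p - 1)-st. For t > 0 all of them are positive; at t = 0
  the positivity of the middle one is the assumption \<open>pos\<close>.\<close>

lemma fin_moment_translate:
  assumes fin: "finite S" and S0: "\<And>y. y \<in> S \<Longrightarrow> 0 \<le> y" and w: "\<And>y. y \<in> S \<Longrightarrow> 0 < w y" "S \<noteq> {}"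
    and p: "2 \<le> p" and k: "2 \<le> k" and h: "0 \<le> h"
    and pos: "0 < fin_moment w S p k"
    and start: "(fin_moment w S p k)\<^sup>2 \<le> fin_moment w S p (k - 1) * fin_moment w S p (k + 1)"
    and lc1: "\<And>t. 0 < t \<Longrightarrow> (fin_exp w S k (\<lambda>s. (s / real k + t) powr (p - 1)))\<^sup>2 \<le>
      fin_exp w S (k - 1) (\<lambda>s. (s / real (k - 1) + t) powr (p - 1)) *
      fin_exp w S (k + 1) (\<lambda>s. (s / real (k + 1) + t) powr (p - 1))"
  shows "(fin_exp w S k (\<lambda>s. (s / real k + h) powr p))\<^sup>2 \<le>
      fin_exp w S (k - 1) (\<lambda>s. (s / real (k - 1) + h) powr p) *
      fin_exp w S (k + 1) (\<lambda>s. (s / real (k + 1) + h) powr p)"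
proof -
  define F where "F q j t = fin_exp w S j (\<lambda>s. (s / real j + t) powr q)" for q j t
  have w0: "\<And>y. y \<in> S \<Longrightarrow> 0 \<le> w y" using w by (simp add: less_imp_le)
  have sum_w: "0 < (\<Sum>y\<in>S. w y)" using fin w by (intro sum_pos) auto
  have cont: "continuous_on {0..} (F p j)" for j
    unfolding F_def using p
    by (intro continuous_on_fin_exp[where a = 0] S0 continuous_on_powr' continuous_intros) auto
  have deriv: "(F p j has_real_derivative p * F (p - 1) j t) (at t)" if "0 < t" for j t
  proof -
    have "(F p j has_real_derivative fin_exp w S j (\<lambda>s. p * (s / real j + t) powr (p - 1))) (at t)"
      unfolding F_def
    proof (rule has_real_derivative_fin_exp[where a = 0, OF S0])
      fix s :: real assume "real j * 0 \<le> s"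
      then have "0 < s / real j + t" using that by (simp add: add_nonneg_pos)
      then show "((\<lambda>t. (s / real j + t) powr p) has_real_derivative p * (s / real j + t) powr (p - 1)) (at t)"
        by (auto intro!: derivative_eq_intros)
    qed auto
    then show ?thesis by (simp add: fin_exp_cmult F_def)
  qed
  have Fpos: "0 < F q j t" if "0 < t" for q j t
    unfolding F_def
  proof (rule fin_exp_pos[OF fin w0 S0 sum_w])
    fix s :: real assume "0 \<le> s"
    then have "0 < s / real j + t" using that by (simp add: add_nonneg_pos)
    then show "0 < (s / real j + t) powr q" by simp
  qed auto
  have F0: "F p j 0 = fin_moment w S p j" for j
    by (simp add: F_def fin_moment_def)
  have "(F p k h)\<^sup>2 \<le> F p (k - 1) h * F p (k + 1) h"
  proof (rule log_convexity_propagates[where p = p and h = h and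
        u = "F p (k - 1)" and v = "F p k" and z = "F p (k + 1)" and ?u1.0 = "F (p - 1) (k - 1)"
        and ?v1.0 = "F (p - 1) k" and ?z1.0 = "F (p - 1) (k + 1)"])
    show "0 < F p k t" if "0 \<le> t" for t
      using that Fpos[of t p k] pos F0[of k] by (cases "t = 0") auto
    show "(F (p - 1) k t)\<^sup>2 \<le> F (p - 1) (k - 1) t * F (p - 1) (k + 1) t" if "0 < t" for t
      using lc1[OF that] by (simp add: F_def)
    show "(F p k 0)\<^sup>2 \<le> F p (k - 1) 0 * F p (k + 1) 0"
      using start by (simp add: F0)
  qed (use cont deriv Fpos p h in \<open>auto simp: less_imp_le\<close>)
  then show ?thesis by (simp add: F_def)
qed

text \<open>The outer induction enlarges the range [1, n + 2) of exponents by 1, the inner one is on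
  the size of the support. The outer hypothesis ranges over all laws because it is applied to the
  translates of the law at hand.\<close>

lemma fin_moment_log_convex:
  assumes "finite S" "\<And>y. y \<in> S \<Longrightarrow> 0 \<le> y" "\<And>y. y \<in> S \<Longrightarrow> 0 \<le> w y"
    and "1 \<le> p" and "2 \<le> k"
  shows "(fin_moment w S p k)\<^sup>2 \<le> fin_moment w S p (k - 1) * fin_moment w S p (k + 1)"
proof -
  have "\<forall>p S w k. finite S \<longrightarrow> (\<forall>y\<in>S. 0 \<le> y) \<longrightarrow> (\<forall>y\<in>S. 0 \<le> w y) \<longrightarrow> 1 \<le> p \<longrightarrow> p < real n + 2 \<longrightarrow> 2 \<le> k \<longrightarrow>
      (fin_moment w S p k)\<^sup>2 \<le> fin_moment w S p (k - 1) * fin_moment w S p (k + 1)" for n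
  proof (induction n)
    case 0
    then show ?case using fin_moment_log_convex_base by simp
  next
    case (Suc n)
    have lower: "(fin_moment w S p k)\<^sup>2 \<le> fin_moment w S p (k - 1) * fin_moment w S p (k + 1)"
      if "finite S" "\<And>y. y \<in> S \<Longrightarrow> 0 \<le> y" "\<And>y. y \<in> S \<Longrightarrow> 0 \<le> w y" "1 \<le> p" "p < real n + 2" "2 \<le> k"
      for p S w k using Suc.IH that by blast
    have main: "(fin_moment w S p k)\<^sup>2 \<le> fin_moment w S p (k - 1) * fin_moment w S p (k + 1)"
      if p: "2 \<le> p" "p < real n + 3" and S: "finite S" "\<And>y. y \<in> S \<Longrightarrow> 0 \<le> y" "\<And>y. y \<in> S \<Longrightarrow> 0 < w y"
        and k: "2 \<le> k" for p S w k
      using S k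
    proof (induction "card S" arbitrary: S w k rule: less_induct)
      case (less S w k)
      show ?case
      proof (cases "S = {}")
        case True
        then obtain j where "k = Suc j" using less.prems(4) by (cases k) auto
        with True show ?thesis by (simp add: fin_moment_def)
      next
        case False
        define m where "m = Min S"
        have m: "m \<in> S" "\<And>y. y \<in> S \<Longrightarrow> m \<le> y" using False less.prems(1) by (auto simp: m_def)
        have m0: "0 \<le> m" using less.prems(2) m(1) by auto
        define S' where "S' = (\<lambda>y. y - m) ` S"
        define v where "v y = w (y + m)" for y
        have S': "finite S'" "0 \<in> S'" "\<And>y. y \<in> S' \<Longrightarrow> 0 \<le> y" "\<And>y. y \<in> S' \<Longrightarrow> 0 < v y" "card S' = card S"
          using less.prems m by (auto simp: S'_def v_def inj_on_def intro!: card_image image_eqI[of _ _ m])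
        have v0: "0 \<le> v y" if "y \<in> S'" for y using S'(4)[OF that] by simp
        have shift: "fin_moment w S p j = fin_exp v S' j (\<lambda>s. (s / real j + m) powr p)" if "1 \<le> j" for j
        proof -
          have "(\<lambda>y. y + m) ` S' = S" by (auto simp: S'_def image_image)
          moreover have "(\<lambda>y. v (y - m)) = w" by (auto simp: v_def)
          ultimately show ?thesis
            using fin_moment_shift[OF S'(1,3) v0 that, where t = m and p = p] by simp
        qed
        show ?thesis
        \<comment> \<open>For a point mass the j-th moment is \<open>v 0 ^ j * m powr p\<close>,
          geometric in j, so equality holds.\<close>
        proof (cases "S' - {0} = {}")
          case True
          then have "S' = {0}" using S'(2) by auto
          then have "fin_exp v S' j g = v 0 ^ j * g 0" for j g
            by (induction j arbitrary: g) auto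
          then have *: "fin_moment w S p j = v 0 ^ j * m powr p" if "1 \<le> j" for j
            using shift[OF that] by simp
          obtain i where "k = Suc i" "1 \<le> i" using less.prems(4) by (cases k) auto
          then show ?thesis
            using *[of k] *[of "k - 1"] *[of "k + 1"] by (simp add: power2_eq_square mult_ac)
        next
          case ne: False
          have card: "card (S' - {0}) < card S"
            using S'(1,2,5) by (metis card_Diff1_less)
          \<comment> \<open>Removing 0 shrinks the support and lowers the mass; the inner hypothesis
            asks for no normalisation.\<close>
          have IH: "(fin_moment v (S' - {0}) p j)\<^sup>2 \<le> fin_moment v (S' - {0}) p (j - 1) * fin_moment v (S' - {0}) p (j + 1)"
            if "2 \<le> j" for j
            using S' that by (intro less.hyps[OF card]) auto
          have p1: "1 \<le> p" using p by simp
          have S'pos: "0 < y" if "y \<in> S'" "y \<noteq> 0" for y using S'(3)[OF that(1)] that(2) by simp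
          have k: "2 \<le> k" "1 \<le> k" "1 \<le> k - 1" "1 \<le> k + 1" using less.prems(4) by auto
          have start: "(fin_moment v S' p k)\<^sup>2 \<le> fin_moment v S' p (k - 1) * fin_moment v S' p (k + 1)"
            by (rule fin_moment_thinning(1)[OF S'(1,2) S'pos S'(4) ne p1 IH k(1)])
          have start_pos: "0 < fin_moment v S' p k"
            by (rule fin_moment_thinning(2)[OF S'(1,2) S'pos S'(4) ne p1 IH k(2)])
          \<comment> \<open>The translated moments are moments of the law of X + t, and p - 1 lies
            in [1, n + 2), so the outer hypothesis applies.\<close>
          have lc1: "(fin_exp v S' k (\<lambda>s. (s / real k + t) powr (p - 1)))\<^sup>2 \<le>
              fin_exp v S' (k - 1) (\<lambda>s. (s / real (k - 1) + t) powr (p - 1)) *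
              fin_exp v S' (k + 1) (\<lambda>s. (s / real (k + 1) + t) powr (p - 1))" if "0 < t" for t
          proof -
            have e: "fin_exp v S' j (\<lambda>s. (s / real j + t) powr (p - 1)) =
                fin_moment (\<lambda>y. v (y - t)) ((\<lambda>y. y + t) ` S') (p - 1) j" if "1 \<le> j" for j
              by (rule fin_moment_shift[OF S'(1,3) v0 that])
            show ?thesis
              unfolding e[OF k(2)] e[OF k(3)] e[OF k(4)]
              using S' that p k by (intro lower) (auto simp: less_imp_le)
          qed
          show ?thesis
            unfolding shift[OF k(2)] shift[OF k(3)] shift[OF k(4)]
            by (rule fin_moment_translate[OF S'(1,3,4) _ p(1) k(1) m0 start_pos start lc1])
              (use S'(2) in auto)
        qed
      qed
    qed
    show ?case
    proof (intro allI impI)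
      fix p :: real and S :: "real set" and w :: "real \<Rightarrow> real" and k :: nat
      assume A: "finite S" "\<forall>y\<in>S. 0 \<le> y" "\<forall>y\<in>S. 0 \<le> w y" "1 \<le> p" "p < real (Suc n) + 2" "2 \<le> k"
      show "(fin_moment w S p k)\<^sup>2 \<le> fin_moment w S p (k - 1) * fin_moment w S p (k + 1)"
      proof (cases "p < 2")
        case True
        then show ?thesis using A by (intro fin_moment_log_convex_base) auto
      next
        case False
        \<comment> \<open>\<open>main\<close> needs strictly positive weights, so atoms of weight 0
          are dropped first.\<close>
        have "(fin_moment w {y \<in> S. w y \<noteq> 0} p k)\<^sup>2 \<le>
            fin_moment w {y \<in> S. w y \<noteq> 0} p (k - 1) * fin_moment w {y \<in> S. w y \<noteq> 0} p (k + 1)"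
          using A False by (intro main) (auto simp: order_less_le)
        then show ?thesis
          unfolding fin_moment_def fin_exp_restrict_support[OF A(1), symmetric] .
      qed
    qed
  qed
  moreover obtain n where "p < real n + 2"
    using reals_Archimedean2[of "p - 2"] by (auto simp: algebra_simps)
  ultimately show ?thesis using assms by blast
qed

section \<open>Majorization\<close>

text \<open>Abel summation: by induction, e(j) times the partial sum of d through j is at most the
  weighted partial sum. At the last index the former is 0.\<close>

lemma abel_sum_nonneg:
  fixes e d :: "nat \<Rightarrow> real"
  assumes "\<And>i. Suc i < n \<Longrightarrow> e (Suc i) \<le> e i"
    and "\<And>j. j \<le> n \<Longrightarrow> 0 \<le> (\<Sum>i<j. d i)" "(\<Sum>i<n. d i) = 0"
  shows "0 \<le> (\<Sum>i<n. e i * d i)"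
proof (cases n)
  case (Suc m)
  have "j < n \<Longrightarrow> e j * (\<Sum>i<Suc j. d i) \<le> (\<Sum>i<Suc j. e i * d i)" for j
  proof (induction j)
    case (Suc j)
    have "e (Suc j) * (\<Sum>i<Suc j. d i) \<le> e j * (\<Sum>i<Suc j. d i)"
      using Suc.prems assms(1)[of j] assms(2)[of "Suc j"] by (intro mult_right_mono) auto
    then have "e (Suc j) * (\<Sum>i<Suc (Suc j). d i) \<le> e j * (\<Sum>i<Suc j. d i) + e (Suc j) * d (Suc j)"
      by (simp add: distrib_left)
    also have "\<dots> \<le> (\<Sum>i<Suc (Suc j). e i * d i)"
      using Suc by simp
    finally show ?case .
  qed simp
  from this[of m] show ?thesis using Suc assms(3) by simp
qed simp

lemma convex_seq_slope_le:
  fixes g :: "nat \<Rightarrow> real"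
  assumes conv: "\<And>j. m < j \<Longrightarrow> 2 * g j \<le> g (j - 1) + g (j + 1)" and "m \<le> x" "x \<le> y"
  shows "g (Suc x) - g x \<le> g (Suc y) - g y"
  using \<open>x \<le> y\<close>
proof (induction y rule: dec_induct)
  case (step y)
  then show ?case using conv[of "Suc y"] \<open>m \<le> x\<close> by simp
qed simp

text \<open>The forward difference at x is a subgradient: slopes to its right are no smaller, slopes
  to its left no larger.\<close>

lemma convex_seq_subgradient:
  fixes g :: "nat \<Rightarrow> real"
  assumes conv: "\<And>j. m < j \<Longrightarrow> 2 * g j \<le> g (j - 1) + g (j + 1)" and m: "m \<le> x" "m \<le> y"
  shows "(g (Suc x) - g x) * (real y - real x) \<le> g y - g x"
proof (cases "x \<le> y")
  case True
  then show ?thesis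
  proof (induction y rule: dec_induct)
    case (step y)
    then show ?case using convex_seq_slope_le[OF conv m(1) step(1)] by (simp add: algebra_simps)
  qed simp
next
  case False
  then have "y \<le> x" by simp
  then show ?thesis
  proof (induction y rule: inc_induct)
    case (step z)
    have "m \<le> z" using m(2) step by simp
    then show ?case using convex_seq_slope_le[where g = g and m = m and x = z and y = x, OF conv] step
      by (simp add: algebra_simps)
  qed simp
qed

lemma decreasing_rearrangement_map_real:
  "decreasing_rearrangement (map real a) = map real (rev (sort a))"
proof -
  have "sort (map real a) = map real (sort a)"
    by (rule properties_for_sort) (use sorted_sort[of a] in \<open>auto simp: sorted_iff_nth_mono\<close>)
  then show ?thesis by (simp add: decreasing_rearrangement_def rev_map)
qed

lemma prod_nth_rev_sort:
  fixes f :: "'b::linorder \<Rightarrow> 'c::comm_monoid_mult"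
  shows "(\<Prod>i<length a. f (a ! i)) = (\<Prod>i<length a. f (rev (sort a) ! i))"
proof -
  have *: "(\<Prod>i<length xs. f (xs ! i)) = prod_mset (image_mset f (mset xs))" for xs :: "'b list"
  proof -
    have "(\<Prod>i<length xs. f (xs ! i)) = prod_list (map f xs)"
      by (simp add: prod.list_conv_set_nth atLeast0LessThan)
    then show ?thesis by (simp add: prod_mset_prod_list[symmetric])
  qed
  show ?thesis using *[of a] *[of "rev (sort a)"] by simp
qed

text \<open>Karamata's inequality: along the decreasing list a the subgradients of g decrease, so
  Abel summation applies to the differences b - a. Convexity is asked for only beyond m because g
  will be the logarithm of a moment that may be infinite below the least entry of b.\<close>

lemma majorized_nat_lists:
  assumes maj: "map real a \<prec>\<^sub>m\<^sub>a\<^sub>j map real b"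
    and conv: "\<And>j. m < j \<Longrightarrow> 2 * g j \<le> g (j - 1) + (g (j + 1) :: real)"
    and b: "\<And>x. x \<in> set b \<Longrightarrow> m \<le> x"
  shows "\<And>x. x \<in> set a \<Longrightarrow> m \<le> x"
    and "(\<Sum>i<length a. g (rev (sort a) ! i)) \<le> (\<Sum>i<length a. g (rev (sort b) ! i))"
proof -
  define n where "n = length a"
  have nb: "length b = n" using maj by (simp add: majorized_by_def n_def)
  define A where "A = rev (sort a)"
  define B where "B = rev (sort b)"
  have len: "length A = n" "length B = n" by (simp_all add: A_def B_def n_def nb)
  define d where "d i = real (B ! i) - real (A ! i)" for i
  have nth: "map real A ! i = real (A ! i)" "map real B ! i = real (B ! i)" if "i < n" for i
    using that len by auto
  have dsum: "(\<Sum>i<j. d i) = (\<Sum>i<j. map real B ! i) - (\<Sum>i<j. map real A ! i)" if "j \<le> n" for j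
    using that by (simp add: d_def sum_subtractf nth)
  have D: "0 \<le> (\<Sum>i<j. d i)" if "j \<le> n" for j
    using maj that unfolding dsum[OF that]
    by (cases "j = 0") (auto simp: majorized_by_def decreasing_rearrangement_map_real A_def B_def n_def)
  have Dn: "(\<Sum>i<n. d i) = 0"
    using maj unfolding dsum[OF order_refl]
    by (auto simp: majorized_by_def decreasing_rearrangement_map_real A_def B_def n_def)
  have antimono: "A ! j \<le> A ! i" if "i \<le> j" "j < n" for i j
    using that len sorted_nth_mono[of "sort a" "n - Suc j" "n - Suc i"] unfolding A_def
    by (simp add: rev_nth n_def)
  have A: "m \<le> A ! i" if i: "i < n" for i
  proof -
    obtain l where l: "n = Suc l" using i by (cases n) auto
    \<comment> \<open>The last difference is the total 0 minus a nonnegative partial sum, so the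
      least entry of a is at least the least entry of b.\<close>
    have "d l \<le> 0" using D[of l] Dn l by simp
    then have "B ! l \<le> A ! l" by (simp add: d_def)
    moreover have "B ! l \<in> set b" using nth_mem[of l B] len l by (simp add: B_def)
    ultimately show ?thesis using b antimono[of i l] i l by fastforce
  qed
  have Bm: "m \<le> B ! i" if "i < n" for i
    using b nth_mem[of i B] that len by (simp add: B_def)
  show "m \<le> x" if "x \<in> set a" for x
  proof -
    have "x \<in> set A" using that by (simp add: A_def)
    then show ?thesis using A len by (metis in_set_conv_nth)
  qed
  have "0 \<le> (\<Sum>i<n. (g (Suc (A ! i)) - g (A ! i)) * d i)"
  proof (rule abel_sum_nonneg[OF _ D Dn])
    fix i assume "Suc i < n"
    then show "g (Suc (A ! Suc i)) - g (A ! Suc i) \<le> g (Suc (A ! i)) - g (A ! i)"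
      by (intro convex_seq_slope_le[where m = m, OF conv] A antimono) auto
  qed
  also have "\<dots> \<le> (\<Sum>i<n. g (B ! i) - g (A ! i))"
    unfolding d_def using A Bm by (intro sum_mono convex_seq_subgradient[where m = m, OF conv]) auto
  finally show "(\<Sum>i<length a. g (rev (sort a) ! i)) \<le> (\<Sum>i<length a. g (rev (sort b) ! i))"
    by (simp add: sum_subtractf A_def[symmetric] B_def[symmetric] n_def[symmetric])
qed

text \<open>If \<beta> is infinite at an entry of b, the right side is infinite, all factors being
  positive. Otherwise \<beta> is finite from the least entry of b upwards by \<open>fin\<close>, and
  Karamata's inequality applies to its logarithm there.\<close>

lemma prod_le_of_log_convex_ennreal:
  fixes \<beta> :: "nat \<Rightarrow> ennreal"
  assumes lc: "\<And>k. 2 \<le> k \<Longrightarrow> (\<beta> k)\<^sup>2 \<le> \<beta> (k - 1) * \<beta> (k + 1)"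
    and fin: "\<And>k. 1 \<le> k \<Longrightarrow> \<beta> k < \<infinity> \<Longrightarrow> \<beta> (k + 1) < \<infinity>"
    and pos: "\<And>k. 1 \<le> k \<Longrightarrow> 0 < \<beta> k"
    and a: "length a = n" "\<And>x. x \<in> set a \<Longrightarrow> 0 < x" and b: "length b = n" "\<And>x. x \<in> set b \<Longrightarrow> 0 < x"
    and maj: "map real a \<prec>\<^sub>m\<^sub>a\<^sub>j map real b"
  shows "(\<Prod>j<n. \<beta> (a ! j)) \<le> (\<Prod>j<n. \<beta> (b ! j))"
proof (cases "\<exists>x\<in>set b. \<beta> x = \<infinity>")
  case True
  then obtain i where i: "i < n" "\<beta> (b ! i) = \<infinity>" using b(1) by (metis in_set_conv_nth)
  have "(\<Prod>j\<in>{..<n} - {i}. \<beta> (b ! j)) \<noteq> 0"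
    using b pos by (auto simp: prod_zero_iff) (metis One_nat_def Suc_leI less_irrefl nth_mem)
  then have "(\<Prod>j<n. \<beta> (b ! j)) = \<infinity>"
    using i by (subst prod.remove[of _ i]) (auto simp: ennreal_top_mult)
  then show ?thesis by simp
next
  case False
  show ?thesis
  proof (cases "n = 0")
    case n: False
    define m where "m = Min (set b)"
    have m: "m \<in> set b" "\<And>x. x \<in> set b \<Longrightarrow> m \<le> x"
      unfolding m_def using n b(1) by auto
    have m1: "1 \<le> m" using b(2)[OF m(1)] by simp
    have finite: "\<beta> k < \<infinity>" if "m \<le> k" for k
      using that
    proof (induction k rule: dec_induct)
      case base
      show ?case using False m(1) by (auto simp: less_top)
    next
      case (step k)
      then show ?case using fin[of k] m1 by auto
    qed
    define g where "g k = ln (enn2real (\<beta> k))" for k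
    have r: "0 < enn2real (\<beta> k)" "ennreal (enn2real (\<beta> k)) = \<beta> k" if "m \<le> k" for k
      using finite[OF that] pos[of k] that m1 by (auto simp: enn2real_positive_iff)
    have eg: "\<beta> k = ennreal (exp (g k))" if "m \<le> k" for k
      using r[OF that] by (simp add: g_def)
    have conv: "2 * g k \<le> g (k - 1) + g (k + 1)" if "m < k" for k
    proof -
      have "(ennreal (exp (g k)))\<^sup>2 \<le> ennreal (exp (g (k - 1))) * ennreal (exp (g (k + 1)))"
        using lc[of k] eg[of k] eg[of "k - 1"] eg[of "k + 1"] that m1 by auto
      then have "exp (2 * g k) \<le> exp (g (k - 1) + g (k + 1))"
        by (simp add: power2_eq_square ennreal_mult[symmetric] exp_add exp_double)
      then show ?thesis by simp
    qed
    have am: "m \<le> x" if "x \<in> set a" for x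
      by (rule majorized_nat_lists(1)[where m = m and g = g, OF maj conv m(2) that])
    have le: "(\<Sum>i<n. g (rev (sort a) ! i)) \<le> (\<Sum>i<n. g (rev (sort b) ! i))"
      using majorized_nat_lists(2)[where m = m and g = g, OF maj conv m(2)] a(1) by simp
    have prod: "(\<Prod>i<n. \<beta> (c ! i)) = ennreal (exp (\<Sum>i<n. g (rev (sort c) ! i)))"
      if "length c = n" "\<And>x. x \<in> set c \<Longrightarrow> m \<le> x" for c
    proof -
      have "(\<Prod>i<n. \<beta> (c ! i)) = (\<Prod>i<n. \<beta> (rev (sort c) ! i))"
        using prod_nth_rev_sort[of \<beta> c] that(1) by simp
      also have "\<dots> = (\<Prod>i<n. ennreal (exp (g (rev (sort c) ! i))))"
      proof (rule prod.cong[OF refl])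
        fix i assume "i \<in> {..<n}"
        then have "rev (sort c) ! i \<in> set c"
          using nth_mem[of i "rev (sort c)"] that(1) by simp
        then show "\<beta> (rev (sort c) ! i) = ennreal (exp (g (rev (sort c) ! i)))"
          using that(2) eg by blast
      qed
      finally show ?thesis by (simp add: prod_ennreal exp_sum)
    qed
    have "(\<Prod>j<n. \<beta> (a ! j)) = ennreal (exp (\<Sum>i<n. g (rev (sort a) ! i)))"
      by (rule prod[OF a(1) am])
    moreover have "(\<Prod>j<n. \<beta> (b ! j)) = ennreal (exp (\<Sum>i<n. g (rev (sort b) ! i)))"
      by (rule prod[OF b(1) m(2)])
    ultimately show ?thesis using le by (simp add: ennreal_leI)
  qed simp
qed

text \<open>The reciprocals of a positive finite log-concave sequence are log-convex, which reduces
  this to the previous lemma.\<close>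

lemma prod_ge_of_log_concave_ennreal:
  fixes \<beta> :: "nat \<Rightarrow> ennreal"
  assumes lc: "\<And>k. 2 \<le> k \<Longrightarrow> \<beta> (k - 1) * \<beta> (k + 1) \<le> (\<beta> k)\<^sup>2"
    and fin: "\<And>k. 1 \<le> k \<Longrightarrow> \<beta> k < \<infinity>"
    and pos: "\<And>k. 1 \<le> k \<Longrightarrow> 0 < \<beta> k"
    and a: "length a = n" "\<And>x. x \<in> set a \<Longrightarrow> 0 < x" and b: "length b = n" "\<And>x. x \<in> set b \<Longrightarrow> 0 < x"
    and maj: "map real a \<prec>\<^sub>m\<^sub>a\<^sub>j map real b"
  shows "(\<Prod>j<n. \<beta> (b ! j)) \<le> (\<Prod>j<n. \<beta> (a ! j))"
proof -
  define r where "r k = enn2real (\<beta> k)" for k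
  have r: "0 < r k" "\<beta> k = ennreal (r k)" if "1 \<le> k" for k
    using fin[OF that] pos[OF that] by (auto simp: r_def enn2real_positive_iff)
  define \<gamma> where "\<gamma> k = ennreal (1 / r k)" for k
  have prod: "(\<Prod>j<n. \<beta> (c ! j)) = ennreal (\<Prod>j<n. r (c ! j))" "(\<Prod>j<n. \<gamma> (c ! j)) = ennreal (1 / (\<Prod>j<n. r (c ! j)))"
    "0 < (\<Prod>j<n. r (c ! j))"
    if "length c = n" "\<And>x. x \<in> set c \<Longrightarrow> 0 < x" for c
  proof -
    have *: "1 \<le> c ! j" if "j \<in> {..<n}" for j
      using \<open>\<And>x. x \<in> set c \<Longrightarrow> 0 < x\<close>[OF nth_mem[of j c]] that \<open>length c = n\<close> by simp
    show "(\<Prod>j<n. \<beta> (c ! j)) = ennreal (\<Prod>j<n. r (c ! j))"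
      using r(2)[OF *] r(1)[OF *] by (subst prod_ennreal[symmetric]) (auto intro: less_imp_le prod.cong)
    show "(\<Prod>j<n. \<gamma> (c ! j)) = ennreal (1 / (\<Prod>j<n. r (c ! j)))"
      unfolding \<gamma>_def using r(1)[OF *] by (subst prod_ennreal) (auto intro: less_imp_le simp: prod_dividef)
    show "0 < (\<Prod>j<n. r (c ! j))" using r(1)[OF *] by (intro prod_pos) auto
  qed
  have "(\<Prod>j<n. \<gamma> (a ! j)) \<le> (\<Prod>j<n. \<gamma> (b ! j))"
  proof (rule prod_le_of_log_convex_ennreal[OF _ _ _ a b maj])
    fix k :: nat assume k: "2 \<le> k"
    have rk: "0 < r k" "0 < r (k - 1)" "0 < r (k + 1)" using k r(1) by auto
    have "ennreal (r (k - 1) * r (k + 1)) \<le> ennreal ((r k)\<^sup>2)"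
      using lc[OF k] r[of k] r[of "k - 1"] r[of "k + 1"] k
      by (simp add: ennreal_mult[symmetric] ennreal_power less_imp_le)
    then have "r (k - 1) * r (k + 1) \<le> (r k)\<^sup>2" by (simp add: ennreal_le_iff)
    then have "1 / (r k)\<^sup>2 \<le> 1 / (r (k - 1) * r (k + 1))"
      using rk by (intro divide_left_mono) auto
    then show "(\<gamma> k)\<^sup>2 \<le> \<gamma> (k - 1) * \<gamma> (k + 1)"
      using rk by (simp add: \<gamma>_def ennreal_mult[symmetric] ennreal_power power_divide ennreal_leI)
  qed (use r in \<open>auto simp: \<gamma>_def\<close>)
  then have "1 / (\<Prod>j<n. r (a ! j)) \<le> 1 / (\<Prod>j<n. r (b ! j))"
    using prod[OF a] prod[OF b] by (simp add: ennreal_le_iff)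
  then have "(\<Prod>j<n. r (b ! j)) \<le> (\<Prod>j<n. r (a ! j))"
    using prod(3)[OF a] prod(3)[OF b] by (simp add: field_simps)
  moreover have "(\<Prod>j<n. \<beta> (a ! j)) = ennreal (\<Prod>j<n. r (a ! j))"
    by (rule prod(1)[OF a])
  moreover have "(\<Prod>j<n. \<beta> (b ! j)) = ennreal (\<Prod>j<n. r (b ! j))"
    by (rule prod(1)[OF b])
  ultimately show ?thesis by (simp add: ennreal_leI)
qed

section \<open>General laws\<close>

text \<open>Positivity of u and z rules out the product 0 times infinity; when both are finite, c =
  1 shows that v is finite too.\<close>

lemma square_le_mult_if_linear_ennreal:
  fixes u v z :: ennreal
  assumes "0 < u" "0 < z" and lin: "\<And>c. 0 < c \<Longrightarrow> 2 * v \<le> ennreal c * u + ennreal (1 / c) * z"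
  shows "v\<^sup>2 \<le> u * z"
proof (cases "u = \<infinity> \<or> z = \<infinity>")
  case True
  then show ?thesis using assms(1,2) by (auto simp: ennreal_top_mult ennreal_mult_top)
next
  case False
  then obtain a b where ab: "u = ennreal a" "0 \<le> a" "z = ennreal b" "0 \<le> b"
    by (cases u; cases z) auto
  have "2 * v \<le> u + z" using lin[of 1] by simp
  then have "v \<noteq> \<infinity>" using ab by (auto simp: ennreal_mult_top top_unique)
  then obtain r where r: "v = ennreal r" "0 \<le> r" by (cases v) auto
  have "r\<^sup>2 \<le> a * b"
  proof (rule square_le_mult_if_linear[OF ab(2) r(2) ab(4)])
    fix c :: real assume c: "0 < c"
    have "ennreal (2 * r) = 2 * v" by (simp add: r ennreal_mult')
    also have "\<dots> \<le> ennreal c * u + ennreal (1 / c) * z" by (rule lin[OF c])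
    also have "\<dots> = ennreal (c * a + 1 / c * b)"
      using ab c by (subst ennreal_plus) (auto simp: ennreal_mult[symmetric])
    finally show "2 * r \<le> c * a + b / c" using ab c by (subst (asm) ennreal_le_iff) auto
  qed
  then show ?thesis using ab r by (simp add: ennreal_power ennreal_mult[symmetric] ennreal_leI)
qed

text \<open>AM-GM: concavity in k is stronger than log-concavity.\<close>

lemma square_ge_mult_if_concave_ennreal:
  fixes u v z :: ennreal
  assumes "u + z \<le> 2 * v"
  shows "u * z \<le> v\<^sup>2"
proof (cases "v = \<infinity>")
  case True
  then show ?thesis by simp
next
  case False
  then obtain r where r: "v = ennreal r" "0 \<le> r" by (cases v) auto
  then have "u + z \<le> ennreal (2 * r)" using assms by (simp add: ennreal_mult')
  then have "u + z < \<infinity>" by (rule le_less_trans) simp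
  then obtain a b where ab: "u = ennreal a" "0 \<le> a" "z = ennreal b" "0 \<le> b"
    by (cases u; cases z) auto
  have "a + b \<le> 2 * r"
    using \<open>u + z \<le> ennreal (2 * r)\<close> ab r by (simp add: ennreal_plus[symmetric] del: ennreal_plus)
  then have "(a + b)\<^sup>2 \<le> (2 * r)\<^sup>2" using ab by (intro power_mono) auto
  moreover have "4 * (a * b) \<le> (a + b)\<^sup>2"
    using zero_le_power2[of "a - b"] by (simp add: power2_eq_square algebra_simps)
  ultimately have "a * b \<le> r\<^sup>2" by (simp add: power_mult_distrib)
  then show ?thesis using ab r by (simp add: ennreal_power ennreal_mult[symmetric] ennreal_leI)
qed

section \<open>Extended powers and the Gamma integral\<close>

lemma ext_powr_pos: "0 < p \<Longrightarrow> ext_powr x p = ennreal (x powr p)"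
  by (simp add: ext_powr_def)

lemma ext_powr_neg_pos: "p < 0 \<Longrightarrow> 0 < ext_powr x p"
  by (simp add: ext_powr_def)

lemma measurable_ext_powr [measurable]: "(\<lambda>x. ext_powr x p) \<in> borel_measurable borel"
  unfolding ext_powr_def by measurable

text \<open>For x > 0 substitute t/x for t in the Gamma integral. At x = 0 both sides are infinite,
  which is where the convention for 0^p enters.\<close>

lemma ext_powr_laplace:
  assumes p: "p < 0" and x: "0 \<le> x"
  shows "ext_powr x p * ennreal (Gamma (- p)) =
    (\<integral>\<^sup>+ t. ennreal (indicator {0<..} t * t powr (- p - 1) * exp (- (t * x))) \<partial>lborel)"
proof -
  define I where "I x = (\<integral>\<^sup>+ t. ennreal (indicator {0<..} t * t powr (- p - 1) * exp (- (t * x))) \<partial>lborel)" for x :: real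
  have pos: "I x = ennreal (x powr p * Gamma (- p))" if x: "0 < x" for x
  proof -
    have "I x = \<bar>1 / x\<bar> * (\<integral>\<^sup>+ t. ennreal (indicator {0<..} (0 + 1 / x * t) * (0 + 1 / x * t) powr (- p - 1) *
        exp (- ((0 + 1 / x * t) * x))) \<partial>lborel)"
      unfolding I_def using x by (intro nn_integral_real_affine) auto
    also have "(\<integral>\<^sup>+ t. ennreal (indicator {0<..} (0 + 1 / x * t) * (0 + 1 / x * t) powr (- p - 1) *
        exp (- ((0 + 1 / x * t) * x))) \<partial>lborel) =
        (\<integral>\<^sup>+ t. ennreal (x powr (p + 1)) * ennreal (indicator {0..} t * t powr (- p - 1) / exp t) \<partial>lborel)"
    proof (intro nn_integral_cong)
      fix t :: real
      show "ennreal (indicator {0<..} (0 + 1 / x * t) * (0 + 1 / x * t) powr (- p - 1) *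
        exp (- ((0 + 1 / x * t) * x))) =
        ennreal (x powr (p + 1)) * ennreal (indicator {0..} t * t powr (- p - 1) / exp t)"
      proof (cases "0 < t")
        case True
        have "(t / x) powr (- p - 1) = t powr (- p - 1) * x powr (p + 1)"
          using x True powr_minus_divide[of x "p + 1"] by (simp add: powr_divide)
        then show ?thesis
          using x True by (simp add: ennreal_mult[symmetric] exp_minus field_simps)
      qed (use x in \<open>auto simp: indicator_def zero_less_divide_iff\<close>)
    qed
    also have "\<dots> = ennreal (x powr (p + 1)) * ennreal (Gamma (- p))"
      using p Gamma_conv_nn_integral_real[of "- p"] by (subst nn_integral_cmult) auto
    also have "ennreal \<bar>1 / x\<bar> * \<dots> = ennreal (1 / x * x powr (p + 1) * Gamma (- p))"
      using x p Gamma_real_pos[of "- p"] by (simp add: ennreal_mult[symmetric] mult.assoc)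
    also have "1 / x * x powr (p + 1) = x powr p"
      using x by (simp add: powr_add)
    finally show ?thesis .
  qed
  show ?thesis
  proof (cases "x = 0")
    case False
    then show ?thesis using pos[of x] x p Gamma_real_pos[of "- p"]
      by (simp add: ext_powr_def I_def ennreal_mult less_imp_le)
  next
    case True
    have G: "0 < Gamma (- p)" using p by (intro Gamma_real_pos) simp
    have "I 0 = \<infinity>"
    proof (rule ccontr)
      assume "I 0 \<noteq> \<infinity>"
      then obtain r where r: "I 0 = ennreal r" "0 \<le> r" by (cases "I 0") auto
      \<comment> \<open>Chosen so that I(y) = r + 1, which exceeds I(0) = r although I is
        decreasing.\<close>
      define y where "y = ((r + 1) / Gamma (- p)) powr (1 / p)"
      have y: "0 < y" "y powr p * Gamma (- p) = r + 1"
        using r p G less_imp_neq[OF G] by (auto simp: y_def powr_powr)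
      have "I y \<le> I 0"
        unfolding I_def
      proof (intro nn_integral_mono ennreal_leI)
        fix t :: real
        show "indicator {0<..} t * t powr (- p - 1) * exp (- (t * y)) \<le>
            indicator {0<..} t * t powr (- p - 1) * exp (- (t * 0))"
          using y(1) by (cases "0 < t") (auto intro!: mult_left_le)
      qed
      then show False using pos[OF y(1)] y(2) r by simp
    qed
    moreover have "\<infinity> * ennreal (Gamma (- p)) = \<infinity>" using G by (simp add: ennreal_top_mult)
    ultimately show ?thesis using True p by (simp add: ext_powr_def I_def)
  qed
qed

lemma (in prob_space) nn_integral_indep_var_mult:
  assumes "indep_var borel A borel B"
    and [measurable]: "f \<in> borel_measurable borel" "g \<in> borel_measurable borel"
  shows "(\<integral>\<^sup>+\<omega>. f (A \<omega>) * g (B \<omega>) \<partial>M) = (\<integral>\<^sup>+\<omega>. f (A \<omega>) \<partial>M) * (\<integral>\<^sup>+\<omega>. (g (B \<omega>) :: ennreal) \<partial>M)"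
proof -
  have "indep_var borel (f \<circ> A) borel (g \<circ> B)"
    by (rule indep_var_compose[OF assms(1)]) auto
  then have "indep_vars (\<lambda>_. borel) (case_bool (f \<circ> A) (g \<circ> B)) UNIV"
    unfolding indep_var_def by (rule indep_vars_cong[THEN iffD1, rotated 3]) (auto split: bool.split)
  from indep_vars_nn_integral[OF _ this] show ?thesis
    by (simp add: UNIV_bool mult.commute comp_def)
qed

text \<open>Nonnegativity holds everywhere here, not just almost surely; the final theorem passes to
  the positive parts.\<close>

locale iid_nonneg = prob_space M for M :: "'a measure" +
  fixes X :: "nat \<Rightarrow> 'a \<Rightarrow> real"
  assumes indep: "indep_vars (\<lambda>_. borel) X {1..}"
    and ident: "\<And>i. 1 \<le> i \<Longrightarrow> distr M borel (X i) = distr M borel (X 1)"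
    and nonneg: "\<And>i \<omega>. 0 \<le> X i \<omega>"
begin

lemma rv: "1 \<le> i \<Longrightarrow> X i \<in> borel_measurable M"
  using indep by (auto simp: indep_vars_def)

lemma measurable_sum [measurable]: "(\<lambda>\<omega>. \<Sum>i\<in>{1..k}. X i \<omega>) \<in> borel_measurable M"
  by (intro borel_measurable_sum rv) auto

lemmas measurable_sum_Suc_0 [measurable] = measurable_sum[unfolded One_nat_def]

lemma rv_1 [measurable]: "X (Suc 0) \<in> borel_measurable M"
  using rv[of 1] by simp

lemma nn_integral_ident:
  assumes "1 \<le> i" and [measurable]: "f \<in> borel_measurable borel"
  shows "(\<integral>\<^sup>+\<omega>. f (X i \<omega>) \<partial>M) = (\<integral>\<^sup>+\<omega>. f (X 1 \<omega>) \<partial>M)"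
proof -
  have "(\<integral>\<^sup>+\<omega>. f (X i \<omega>) \<partial>M) = (\<integral>\<^sup>+x. f x \<partial>distr M borel (X i))"
    using rv[OF assms(1)] by (simp add: nn_integral_distr)
  also have "\<dots> = (\<integral>\<^sup>+\<omega>. f (X 1 \<omega>) \<partial>M)"
    unfolding ident[OF assms(1)] by (simp add: nn_integral_distr)
  finally show ?thesis .
qed

lemma sample_mean_nonneg: "0 \<le> (\<Sum>i\<in>{1..k}. X i \<omega>) / real k"
  by (intro divide_nonneg_nonneg sum_nonneg nonneg) auto

section \<open>Laplace transforms of sample means and negative exponents\<close>

definition laplace :: "real \<Rightarrow> real" where
  "laplace u = expectation (\<lambda>\<omega>. exp (- (u * X 1 \<omega>)))"

lemma integrable_exp: "0 \<le> u \<Longrightarrow> integrable M (\<lambda>\<omega>. exp (- (u * X 1 \<omega>)))"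
  by (rule integrable_const_bound[where B = 1]) (auto simp: nonneg)

lemma laplace_pos: "0 \<le> u \<Longrightarrow> 0 < laplace u"
  unfolding laplace_def using expectation_greater[OF integrable_exp, of u 0] by simp

lemma laplace_0: "laplace 0 = 1"
  by (simp add: laplace_def prob_space)

text \<open>Hoelder's inequality, proved by convexity of exp at exponents s and t normalised so that
  exp(s) and exp(t) have expectation 1.\<close>

lemma ln_laplace_convex:
  assumes "0 \<le> a" "0 \<le> b" "a + b = 1" "0 \<le> u" "0 \<le> v"
  shows "ln (laplace (a * u + b * v)) \<le> a * ln (laplace u) + b * ln (laplace v)"
proof -
  define c where "c = a * ln (laplace u) + b * ln (laplace v)"
  have uv: "0 \<le> a * u + b * v" using assms by simp
  have "exp (- c) * exp (- ((a * u + b * v) * X 1 \<omega>)) \<le>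
      a / laplace u * exp (- (u * X 1 \<omega>)) + b / laplace v * exp (- (v * X 1 \<omega>))" for \<omega>
  proof -
    define s where "s = - (u * X 1 \<omega>) - ln (laplace u)"
    define t where "t = - (v * X 1 \<omega>) - ln (laplace v)"
    have "a = 1 - b" "b \<le> 1" using assms by auto
    then have "exp (a * s + b * t) \<le> a * exp s + b * exp t"
      using convex_onD[OF exp_convex, of b s t] assms(2) by simp
    moreover have "exp (a * s + b * t) = exp (- c) * exp (- ((a * u + b * v) * X 1 \<omega>))"
      by (simp add: s_def t_def c_def exp_add[symmetric] algebra_simps)
    ultimately show ?thesis
      using laplace_pos assms(4,5) by (simp add: s_def t_def exp_diff)
  qed
  then have "expectation (\<lambda>\<omega>. exp (- c) * exp (- ((a * u + b * v) * X 1 \<omega>))) \<le>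
      expectation (\<lambda>\<omega>. a / laplace u * exp (- (u * X 1 \<omega>)) + b / laplace v * exp (- (v * X 1 \<omega>)))"
    using assms uv by (intro integral_mono integrable_mult_right Bochner_Integration.integrable_add integrable_exp) auto
  also have "\<dots> = a / laplace u * laplace u + b / laplace v * laplace v"
    using assms integrable_exp[of u] integrable_exp[of v]
    by (subst Bochner_Integration.integral_add) (simp_all add: laplace_def)
  also have "\<dots> = 1"
    using laplace_pos[OF assms(4)] laplace_pos[OF assms(5)] assms(3) by simp
  finally have "exp (- c) * laplace (a * u + b * v) \<le> 1"
    by (simp add: laplace_def)
  then have "laplace (a * u + b * v) \<le> exp c"
    by (simp add: exp_minus field_simps)
  then have "ln (laplace (a * u + b * v)) \<le> ln (exp c)"
    using laplace_pos[OF uv] by (subst ln_le_cancel_iff) auto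
  then show ?thesis by (simp add: c_def)
qed

lemma nn_integral_exp_sample_mean:
  assumes k: "1 \<le> k" and t: "0 \<le> t"
  shows "(\<integral>\<^sup>+\<omega>. ennreal (exp (- (t * ((\<Sum>i\<in>{1..k}. X i \<omega>) / real k)))) \<partial>M) =
    ennreal (exp (real k * ln (laplace (t / real k))))"
proof -
  define u where "u = t / real k"
  have u: "0 \<le> u" using t by (simp add: u_def)
  have ind: "indep_vars (\<lambda>_. borel) (\<lambda>i \<omega>. ennreal (exp (- (u * X i \<omega>)))) {1..k}"
    by (rule indep_vars_compose2[OF indep_vars_subset[OF indep], where Y = "\<lambda>i x. ennreal (exp (- (u * x)))"]) auto
  have "(\<integral>\<^sup>+\<omega>. ennreal (exp (- (t * ((\<Sum>i\<in>{1..k}. X i \<omega>) / real k)))) \<partial>M) =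
      (\<integral>\<^sup>+\<omega>. (\<Prod>i\<in>{1..k}. ennreal (exp (- (u * X i \<omega>)))) \<partial>M)"
    by (intro nn_integral_cong)
      (simp add: prod_ennreal exp_sum[symmetric] sum_negf u_def sum_distrib_left sum_divide_distrib)
  also have "\<dots> = (\<Prod>i\<in>{1..k}. \<integral>\<^sup>+\<omega>. ennreal (exp (- (u * X i \<omega>))) \<partial>M)"
    using ind by (intro indep_vars_nn_integral) auto
  also have "\<dots> = (\<Prod>i\<in>{1..k}. ennreal (laplace u))"
  proof (rule prod.cong[OF refl])
    fix i assume "i \<in> {1..k}"
    then have "(\<integral>\<^sup>+\<omega>. ennreal (exp (- (u * X i \<omega>))) \<partial>M) = (\<integral>\<^sup>+\<omega>. ennreal (exp (- (u * X 1 \<omega>))) \<partial>M)"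
      by (intro nn_integral_ident) auto
    then show "(\<integral>\<^sup>+\<omega>. ennreal (exp (- (u * X i \<omega>))) \<partial>M) = ennreal (laplace u)"
      unfolding laplace_def by (simp add: nn_integral_eq_integral integrable_exp[OF u, simplified])
  qed
  also have "\<dots> = ennreal (laplace u ^ k)"
    using laplace_pos[OF u] by (simp add: ennreal_power)
  also have "laplace u ^ k = exp (real k * ln (laplace u))"
    using laplace_pos[OF u] by (simp add: exp_of_nat_mult)
  finally show ?thesis by (simp add: u_def)
qed

text \<open>The logarithm of the Laplace transform of the k-th sample mean, by
  \<open>nn_integral_exp_sample_mean\<close>.\<close>

definition cumulant :: "nat \<Rightarrow> real \<Rightarrow> real" where
  "cumulant k t = real k * ln (laplace (t / real k))"

text \<open>Perspective of the convex function ln L: with weights (k - 1)/(2k) and (k + 1)/(2k), the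
  points t/(k - 1) and t/(k + 1) average to t/k.\<close>

lemma cumulant_convex:
  assumes "2 \<le> k" "0 \<le> t"
  shows "2 * cumulant k t \<le> cumulant (k - 1) t + cumulant (k + 1) t"
proof -
  define x where "x = real k"
  have x: "2 \<le> x" "real (k - 1) = x - 1" "real (k + 1) = x + 1" using assms by (auto simp: x_def)
  have "ln (laplace ((x - 1) / (2 * x) * (t / (x - 1)) + (x + 1) / (2 * x) * (t / (x + 1)))) \<le>
      (x - 1) / (2 * x) * ln (laplace (t / (x - 1))) + (x + 1) / (2 * x) * ln (laplace (t / (x + 1)))"
    using x assms by (intro ln_laplace_convex) (auto simp: field_simps)
  also have "(x - 1) / (2 * x) * (t / (x - 1)) + (x + 1) / (2 * x) * (t / (x + 1)) = t / (2 * x) + t / (2 * x)"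
    using x(1) by (intro arg_cong2[of _ _ _ _ "(+)"]) auto
  also have "\<dots> = t / x" by simp
  finally have "2 * x * ln (laplace (t / x)) \<le> 2 * x * ((x - 1) / (2 * x) * ln (laplace (t / (x - 1))) +
      (x + 1) / (2 * x) * ln (laplace (t / (x + 1))))"
    using x by (intro mult_left_mono) auto
  also have "\<dots> = (x - 1) * ln (laplace (t / (x - 1))) + (x + 1) * ln (laplace (t / (x + 1)))"
    using x by (simp add: distrib_left)
  finally show ?thesis unfolding cumulant_def x(2,3) x_def[symmetric] by simp
qed

text \<open>Convexity of ln L between t/k and 0, where it vanishes. For p < 0 it makes the moments
  nonincreasing in k, so finiteness propagates upwards.\<close>

lemma cumulant_antimono:
  assumes "1 \<le> k" "0 \<le> t"
  shows "cumulant (k + 1) t \<le> cumulant k t"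
proof -
  define x where "x = real k"
  have x: "1 \<le> x" "real (k + 1) = x + 1" using assms by (auto simp: x_def)
  have "ln (laplace (x / (x + 1) * (t / x) + 1 / (x + 1) * 0)) \<le>
      x / (x + 1) * ln (laplace (t / x)) + 1 / (x + 1) * ln (laplace 0)"
    using x assms by (intro ln_laplace_convex) (auto simp: field_simps)
  then have "ln (laplace (t / (x + 1))) \<le> x / (x + 1) * ln (laplace (t / x))"
    using x by (simp add: laplace_0)
  then have "(x + 1) * ln (laplace (t / (x + 1))) \<le> (x + 1) * (x / (x + 1) * ln (laplace (t / x)))"
    using x by (intro mult_left_mono) auto
  then show ?thesis using x unfolding cumulant_def x(2) x_def[symmetric] by simp
qed

text \<open>Tonelli's theorem applied to \<open>ext_powr_laplace\<close>; the integrand is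
  nonnegative, so infinite moments are covered.\<close>

lemma mean_moment_laplace:
  assumes p: "p < 0" and k: "1 \<le> k"
  defines "H \<equiv> \<lambda>t. ennreal (indicator {0<..} t * t powr (- p - 1) * exp (cumulant k t))"
  shows "mean_moment M X k p * ennreal (Gamma (- p)) = (\<integral>\<^sup>+ t. H t \<partial>lborel)"
    and "H \<in> borel_measurable lborel"
proof -
  interpret pair_sigma_finite M lborel ..
  define Y where "Y \<omega> = (\<Sum>i\<in>{1..k}. X i \<omega>) / real k" for \<omega>
  have [measurable]: "Y \<in> borel_measurable M" unfolding Y_def by measurable
  define F where "F \<omega> t = ennreal (indicator {0<..} t * t powr (- p - 1) * exp (- (t * Y \<omega>)))" for \<omega> and t :: real
  have F [measurable]: "case_prod F \<in> borel_measurable (M \<Otimes>\<^sub>M lborel)"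
    unfolding F_def by measurable
  have H: "(\<integral>\<^sup>+\<omega>. F \<omega> t \<partial>M) = H t" for t
  proof (cases "0 < t")
    case True
    have "(\<integral>\<^sup>+\<omega>. F \<omega> t \<partial>M) = (\<integral>\<^sup>+\<omega>. ennreal (t powr (- p - 1)) * ennreal (exp (- (t * Y \<omega>))) \<partial>M)"
      using True by (simp add: F_def ennreal_mult)
    also have "\<dots> = ennreal (t powr (- p - 1)) * ennreal (exp (cumulant k t))"
      using nn_integral_exp_sample_mean[OF k, of t] True
      by (simp add: nn_integral_cmult cumulant_def Y_def)
    finally show ?thesis using True by (simp add: H_def ennreal_mult)
  qed (simp add: F_def H_def)
  show "H \<in> borel_measurable lborel"
    unfolding H[symmetric, abs_def] by measurable
  have "mean_moment M X k p * ennreal (Gamma (- p)) = (\<integral>\<^sup>+\<omega>. ext_powr (Y \<omega>) p * ennreal (Gamma (- p)) \<partial>M)"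
    unfolding mean_moment_def Y_def[symmetric] by (rule nn_integral_multc[symmetric]) measurable
  also have "\<dots> = (\<integral>\<^sup>+\<omega>. (\<integral>\<^sup>+ t. F \<omega> t \<partial>lborel) \<partial>M)"
    using p sample_mean_nonneg by (simp add: ext_powr_laplace F_def Y_def)
  also have "\<dots> = (\<integral>\<^sup>+ t. (\<integral>\<^sup>+\<omega>. F \<omega> t \<partial>M) \<partial>lborel)"
    by (rule Fubini'[OF F, symmetric])
  finally show "mean_moment M X k p * ennreal (Gamma (- p)) = (\<integral>\<^sup>+ t. H t \<partial>lborel)"
    by (simp add: H)
qed

lemma ennreal_mult_Gamma_cancel:
  assumes "p < 0" "a * ennreal (Gamma (- p)) \<le> b * ennreal (Gamma (- p))"
  shows "a \<le> b"
proof -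
  have G: "0 < Gamma (- p)" using assms(1) by (intro Gamma_real_pos) simp
  have *: "c * ennreal (Gamma (- p)) * ennreal (1 / Gamma (- p)) = c" for c
    using G by (simp add: mult.assoc ennreal_mult[symmetric])
  show ?thesis using mult_right_mono[OF assms(2), of "ennreal (1 / Gamma (- p))"] unfolding * by simp
qed

lemma mean_moment_pos_of_neg:
  assumes "p < 0"
  shows "0 < mean_moment M X k p"
proof (rule ccontr)
  assume "\<not> ?thesis"
  then have "(\<integral>\<^sup>+ \<omega>. ext_powr ((\<Sum>i\<in>{1..k}. X i \<omega>) / real k) p \<partial>M) = 0"
    by (simp add: mean_moment_def)
  then have "AE \<omega> in M. ext_powr ((\<Sum>i\<in>{1..k}. X i \<omega>) / real k) p = 0"
    by (subst (asm) nn_integral_0_iff_AE) auto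
  then have "AE \<omega> in M. False"
    using ext_powr_neg_pos[OF assms] by (auto elim!: eventually_mono simp: less_le)
  then show False by simp
qed

lemma mean_moment_antimono_of_neg:
  assumes p: "p < 0" and k: "1 \<le> k"
  shows "mean_moment M X (k + 1) p \<le> mean_moment M X k p"
proof (rule ennreal_mult_Gamma_cancel[OF p])
  show "mean_moment M X (k + 1) p * ennreal (Gamma (- p)) \<le> mean_moment M X k p * ennreal (Gamma (- p))"
    unfolding mean_moment_laplace(1)[OF p k] mean_moment_laplace(1)[OF p le_add2]
    using cumulant_antimono[OF k]
    by (intro nn_integral_mono ennreal_leI) (auto simp: indicator_def intro!: mult_left_mono)
qed

lemma mean_moment_log_convex_of_neg:
  assumes p: "p < 0" and k: "2 \<le> k"
  shows "(mean_moment M X k p)\<^sup>2 \<le> mean_moment M X (k - 1) p * mean_moment M X (k + 1) p"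
proof (rule square_le_mult_if_linear_ennreal[OF mean_moment_pos_of_neg[OF p] mean_moment_pos_of_neg[OF p]])
  fix c :: real assume c: "0 < c"
  define G where "G = ennreal (Gamma (- p))"
  define H where "H k t = ennreal (indicator {0<..} t * t powr (- p - 1) * exp (cumulant k t))" for k and t :: real
  define k1 where "k1 = k - 1"
  define k2 where "k2 = k + 1"
  have k': "1 \<le> k" "1 \<le> k1" "1 \<le> k2" using k by (auto simp: k1_def k2_def)
  have int: "mean_moment M X j p * G = (\<integral>\<^sup>+ t. H j t \<partial>lborel)" and meas: "H j \<in> borel_measurable lborel"
    if "1 \<le> j" for j
    using mean_moment_laplace[OF p that] by (simp_all add: H_def[abs_def] G_def)
  note [measurable] = meas[OF k'(1)] meas[OF k'(2)] meas[OF k'(3)]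
  have le: "2 * exp (cumulant k t) \<le> c * exp (cumulant k1 t) + 1 / c * exp (cumulant k2 t)"
    if "0 < t" for t
  proof -
    \<comment> \<open>Putting ln c into the exponents leaves s + r unchanged, so convexity of the
      cumulant in k followed by AM-GM gives the weighted inequality.\<close>
    define s where "s = cumulant k1 t + ln c"
    define r where "r = cumulant k2 t - ln c"
    have "exp (cumulant k t) \<le> exp ((s + r) / 2)"
      using cumulant_convex[OF k, of t] that by (simp add: s_def r_def k1_def k2_def)
    moreover have "2 * exp ((s + r) / 2) \<le> exp s + exp r"
    proof -
      have "exp s + exp r - 2 * exp ((s + r) / 2) = (exp (s / 2) - exp (r / 2))\<^sup>2"
        by (simp add: power2_eq_square algebra_simps exp_add[symmetric] add_divide_distrib)
      then show ?thesis by (metis zero_le_power2 diff_ge_0_iff_ge)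
    qed
    moreover have "exp s = c * exp (cumulant k1 t)" "exp r = 1 / c * exp (cumulant k2 t)"
      using c by (simp_all add: s_def r_def exp_add exp_diff)
    ultimately show ?thesis by linarith
  qed
  have "2 * mean_moment M X k p * G = (\<integral>\<^sup>+ t. 2 * H k t \<partial>lborel)"
    using int[OF k'(1)] by (simp add: nn_integral_cmult mult.assoc)
  also have "\<dots> \<le> (\<integral>\<^sup>+ t. ennreal c * H k1 t + ennreal (1 / c) * H k2 t \<partial>lborel)"
  proof (rule nn_integral_mono)
    fix t :: real
    show "2 * H k t \<le> ennreal c * H k1 t + ennreal (1 / c) * H k2 t"
    proof (cases "0 < t")
      case True
      have "t powr (- p - 1) * (2 * exp (cumulant k t)) \<le>
          t powr (- p - 1) * (c * exp (cumulant k1 t) + 1 / c * exp (cumulant k2 t))"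
        by (rule mult_left_mono[OF le[OF True]]) simp
      then have "ennreal (2 * (t powr (- p - 1) * exp (cumulant k t))) \<le>
          ennreal (c * (t powr (- p - 1) * exp (cumulant k1 t)) + 1 / c * (t powr (- p - 1) * exp (cumulant k2 t)))"
        by (intro ennreal_leI) (simp add: algebra_simps)
      also have "\<dots> = ennreal c * ennreal (t powr (- p - 1) * exp (cumulant k1 t)) +
          ennreal (1 / c) * ennreal (t powr (- p - 1) * exp (cumulant k2 t))"
        using c by (subst ennreal_plus) (auto simp: ennreal_mult[symmetric])
      finally show ?thesis using True by (simp add: H_def ennreal_mult')
    qed (simp add: H_def)
  qed
  also have "\<dots> = (ennreal c * mean_moment M X k1 p + ennreal (1 / c) * mean_moment M X k2 p) * G"
    using int[OF k'(2)] int[OF k'(3)] by (simp add: nn_integral_add nn_integral_cmult distrib_right mult.assoc)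
  finally show "2 * mean_moment M X k p \<le> ennreal c * mean_moment M X (k - 1) p + ennreal (1 / c) * mean_moment M X (k + 1) p"
    unfolding G_def k1_def k2_def by (rule ennreal_mult_Gamma_cancel[OF p])
qed

section \<open>Positive exponents by approximation with simple functions\<close>

lemma nn_integral_sum_simple:
  fixes U :: "real \<Rightarrow> real"
  assumes U: "simple_function borel U" and g: "g \<in> borel_measurable borel" "\<And>s. 0 \<le> g s"
  defines "w \<equiv> \<lambda>y. measure (distr M borel (X 1)) (U -` {y})"
  shows "(\<integral>\<^sup>+\<omega>. ennreal (g (\<Sum>i\<in>{1..k}. U (X i \<omega>))) \<partial>M) = ennreal (fin_exp w (range U) k g)"
  using g
proof (induction k arbitrary: g)
  case 0
  then show ?case by (simp add: emeasure_space_1)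
next
  case (Suc k)
  note [measurable] = borel_measurable_simple_function[OF U] Suc.prems(1)
  have fin: "finite (range U)" using simple_functionD(1)[OF U] by simp
  \<comment> \<open>Summing over the finitely many values of the last variable mirrors the recursion
    of \<open>fin_exp\<close>: independence of T and Y splits each term, and the induction
    hypothesis handles the shifted g.\<close>
  define T where "T \<omega> = (\<Sum>i\<in>{1..k}. U (X i \<omega>))" for \<omega>
  define Y where "Y \<omega> = U (X (Suc k) \<omega>)" for \<omega>
  have "indep_vars (\<lambda>_. borel) (\<lambda>i \<omega>. U (X i \<omega>)) (insert (Suc k) {1..k})"
    by (rule indep_vars_compose2[OF indep_vars_subset[OF indep], where Y = "\<lambda>_. U"]) auto
  then have ind: "indep_var borel Y borel T"
    unfolding T_def[abs_def] Y_def[abs_def] by (intro indep_vars_sum) auto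
  have [measurable]: "T \<in> borel_measurable M" "Y \<in> borel_measurable M"
    using indep_var_rv1[OF ind] indep_var_rv2[OF ind] by auto
  have w: "(\<integral>\<^sup>+\<omega>. indicator {y} (Y \<omega>) \<partial>M) = ennreal (w y)" for y
  proof -
    have "(\<integral>\<^sup>+\<omega>. indicator {y} (Y \<omega>) \<partial>M) = (\<integral>\<^sup>+\<omega>. indicator {y} (U (X 1 \<omega>)) \<partial>M)"
      unfolding Y_def by (rule nn_integral_ident[where f = "\<lambda>x. indicator {y} (U x)"]) auto
    also have "\<dots> = (\<integral>\<^sup>+x. indicator (U -` {y}) x \<partial>distr M borel (X 1))"
      by (subst nn_integral_distr) (auto simp: indicator_def)
    also have "\<dots> = emeasure (distr M borel (X 1)) (U -` {y})"
      using simple_functionD(2)[OF U, of "{y}"] by (intro nn_integral_indicator) auto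
    also have "\<dots> = ennreal (w y)"
      unfolding w_def using prob_space_distr[of "X 1" borel]
      by (intro finite_measure.emeasure_eq_measure prob_space.finite_measure) auto
    finally show ?thesis .
  qed
  have w_nonneg: "0 \<le> w y" for y by (simp add: w_def)
  have "(\<integral>\<^sup>+\<omega>. ennreal (g (\<Sum>i\<in>{1..Suc k}. U (X i \<omega>))) \<partial>M) =
      (\<integral>\<^sup>+\<omega>. (\<Sum>y\<in>range U. indicator {y} (Y \<omega>) * ennreal (g (T \<omega> + y))) \<partial>M)"
  proof (rule nn_integral_cong)
    fix \<omega>
    have "(\<Sum>y\<in>range U. indicator {y} (Y \<omega>) * ennreal (g (T \<omega> + y))) =
        (\<Sum>y\<in>range U. if y = Y \<omega> then ennreal (g (T \<omega> + Y \<omega>)) else 0)"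
      by (intro sum.cong) (auto simp: indicator_def)
    also have "\<dots> = ennreal (g (T \<omega> + Y \<omega>))" using fin by (simp add: Y_def)
    finally show "ennreal (g (\<Sum>i\<in>{1..Suc k}. U (X i \<omega>))) =
        (\<Sum>y\<in>range U. indicator {y} (Y \<omega>) * ennreal (g (T \<omega> + y)))"
      by (simp add: T_def Y_def)
  qed
  also have "\<dots> = (\<Sum>y\<in>range U. (\<integral>\<^sup>+\<omega>. indicator {y} (Y \<omega>) * ennreal (g (T \<omega> + y)) \<partial>M))"
    by (rule nn_integral_sum) measurable
  also have "\<dots> = (\<Sum>y\<in>range U. ennreal (w y) * ennreal (fin_exp w (range U) k (\<lambda>s. g (s + y))))"
  proof (rule sum.cong[OF refl])
    fix y
    have "(\<integral>\<^sup>+\<omega>. indicator {y} (Y \<omega>) * ennreal (g (T \<omega> + y)) \<partial>M) =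
        (\<integral>\<^sup>+\<omega>. indicator {y} (Y \<omega>) \<partial>M) * (\<integral>\<^sup>+\<omega>. ennreal (g (T \<omega> + y)) \<partial>M)"
      by (rule nn_integral_indep_var_mult[OF ind, where g = "\<lambda>x. ennreal (g (x + y))"]) measurable
    also have "(\<integral>\<^sup>+\<omega>. ennreal (g (T \<omega> + y)) \<partial>M) = ennreal (fin_exp w (range U) k (\<lambda>s. g (s + y)))"
      unfolding T_def using Suc.prems by (intro Suc.IH) auto
    finally show "(\<integral>\<^sup>+\<omega>. indicator {y} (Y \<omega>) * ennreal (g (T \<omega> + y)) \<partial>M) =
        ennreal (w y) * ennreal (fin_exp w (range U) k (\<lambda>s. g (s + y)))"
      by (simp add: w)
  qed
  also have "\<dots> = ennreal (fin_exp w (range U) (Suc k) g)"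
  proof -
    have nn: "0 \<le> fin_exp w S k h" if "\<And>s. 0 \<le> h s" for h S
      using that by (induction k arbitrary: h) (auto intro!: sum_nonneg mult_nonneg_nonneg w_nonneg)
    show ?thesis
      using w_nonneg nn Suc.prems(2) by (simp add: ennreal_mult[symmetric])
  qed
  finally show ?case .
qed

text \<open>Simple functions increasing to max(0, x) are applied to all variables, and monotone
  convergence yields both the bound and the limit. The laws do not depend on k, so relations between
  k - 1, k and k + 1 carry over.\<close>

lemma mean_moment_approx:
  assumes p: "0 < p"
  obtains w :: "nat \<Rightarrow> real \<Rightarrow> real" and S :: "nat \<Rightarrow> real set"
  where "\<And>n. finite (S n)" "\<And>n y. y \<in> S n \<Longrightarrow> 0 \<le> y" "\<And>n y. 0 \<le> w n y" "\<And>n. (\<Sum>y\<in>S n. w n y) = 1"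
    and "\<And>n k. ennreal (fin_moment (w n) (S n) p k) \<le> mean_moment M X k p"
    and "\<And>k. (\<lambda>n. ennreal (fin_moment (w n) (S n) p k)) \<longlonglongrightarrow> mean_moment M X k p"
proof -
  obtain U :: "nat \<Rightarrow> real \<Rightarrow> real" where U: "incseq U" "\<And>i. simple_function borel (U i)"
    "\<And>x. bdd_above (range (\<lambda>i. U i x))" "\<And>i x. 0 \<le> U i x" "(\<lambda>x. max 0 x) = (SUP i. U i)"
    using borel_measurable_implies_simple_function_sequence_real[of "\<lambda>x::real. max 0 x" borel] by auto
  have mono: "U i x \<le> U j x" if "i \<le> j" for i j x
    using U(1) that by (auto simp: incseq_def le_fun_def)
  have lim: "(\<lambda>i. U i x) \<longlonglongrightarrow> max 0 x" for x
  proof -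
    have "max 0 x = (SUP i. U i x)" using fun_cong[OF U(5), of x] by (simp add: image_image)
    then show ?thesis using LIMSEQ_incseq_SUP[OF U(3), of x] mono by (simp add: incseq_def)
  qed
  define w where "w n y = measure (distr M borel (X 1)) (U n -` {y})" for n y
  define S where "S n = range (U n)" for n
  define B where "B n k \<omega> = ennreal (((\<Sum>i\<in>{1..k}. U n (X i \<omega>)) / real k) powr p)" for n k \<omega>
  have B: "(\<integral>\<^sup>+\<omega>. B n k \<omega> \<partial>M) = ennreal (fin_moment (w n) (S n) p k)" for n k
    unfolding B_def fin_moment_def w_def S_def
    by (rule nn_integral_sum_simple[OF U(2), where g = "\<lambda>s. (s / real k) powr p"]) auto
  have Bmeas: "B n k \<in> borel_measurable M" for n k
  proof -
    have "(\<lambda>\<omega>. U n (X i \<omega>)) \<in> borel_measurable M" if "1 \<le> i" for i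
      using measurable_compose[OF rv[OF that] borel_measurable_simple_function[OF U(2)]] .
    then have [measurable]: "(\<lambda>\<omega>. \<Sum>i\<in>{1..k}. U n (X i \<omega>)) \<in> borel_measurable M"
      by (intro borel_measurable_sum) auto
    show ?thesis unfolding B_def by measurable
  qed
  have Binc: "incseq (\<lambda>n. B n k)" for k
    unfolding B_def using p mono U(4)
    by (auto simp: incseq_def le_fun_def intro!: ennreal_leI powr_mono2 divide_right_mono sum_mono
        divide_nonneg_nonneg sum_nonneg)
  have Blim: "(\<lambda>n. B n k \<omega>) \<longlonglongrightarrow> ext_powr ((\<Sum>i\<in>{1..k}. X i \<omega>) / real k) p" for k \<omega>
  proof -
    have "(\<lambda>n. \<Sum>i\<in>{1..k}. U n (X i \<omega>)) \<longlonglongrightarrow> (\<Sum>i\<in>{1..k}. X i \<omega>)"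
      using lim nonneg by (intro tendsto_sum) (metis max.absorb2)
    from tendsto_mult[OF this tendsto_const[of "inverse (real k)"]]
    have "(\<lambda>n. (\<Sum>i\<in>{1..k}. U n (X i \<omega>)) / real k) \<longlonglongrightarrow> (\<Sum>i\<in>{1..k}. X i \<omega>) / real k"
      by (simp only: divide_inverse)
    moreover have "0 \<le> (\<Sum>i\<in>{1..k}. U n (X i \<omega>)) / real k" for n
      by (intro divide_nonneg_nonneg sum_nonneg U(4)) auto
    ultimately have "(\<lambda>n. ((\<Sum>i\<in>{1..k}. U n (X i \<omega>)) / real k) powr p) \<longlonglongrightarrow> ((\<Sum>i\<in>{1..k}. X i \<omega>) / real k) powr p"
      using p by (intro tendsto_powr2 tendsto_const) auto
    then show ?thesis unfolding B_def ext_powr_pos[OF p] by (rule tendsto_ennrealI)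
  qed
  have conv: "(\<lambda>n. ennreal (fin_moment (w n) (S n) p k)) \<longlonglongrightarrow> mean_moment M X k p" for k
    unfolding B[symmetric] mean_moment_def by (rule nn_integral_LIMSEQ[OF Binc Bmeas Blim])
  have "incseq (\<lambda>n. ennreal (fin_moment (w n) (S n) p k))" for k
    unfolding B[symmetric] using incseq_nn_integral[OF Binc] .
  then have le: "ennreal (fin_moment (w n) (S n) p k) \<le> mean_moment M X k p" for n k
    using incseq_le[OF _ conv] by blast
  have fin: "finite (S n)" for n using simple_functionD(1)[OF U(2)] by (simp add: S_def)
  have nn: "0 \<le> y" if "y \<in> S n" for n y using that U(4) by (auto simp: S_def)
  have w0: "0 \<le> w n y" for n y by (simp add: w_def)
  have sum1: "(\<Sum>y\<in>S n. w n y) = 1" for n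
  proof -
    \<comment> \<open>The total mass is read off from a single variable and the constant function
      1.\<close>
    have "ennreal (fin_exp (w n) (S n) 1 (\<lambda>_. 1)) = 1"
      using nn_integral_sum_simple[OF U(2)[of n], of "\<lambda>_. 1" 1, symmetric]
      by (simp add: w_def[abs_def] S_def emeasure_space_1)
    then show ?thesis unfolding fin_exp_const using w0 by (simp add: sum_nonneg)
  qed
  show thesis by (rule that[OF fin _ w0 sum1 le conv]) (rule nn)
qed

text \<open>The right side is bounded by its limit value before passing to the limit on the left; so
  no limit of a product, possibly 0 times infinity, is taken.\<close>

lemma mean_moment_log_convex_of_ge_1:
  assumes p: "1 \<le> p" and k: "2 \<le> k"
  shows "(mean_moment M X k p)\<^sup>2 \<le> mean_moment M X (k - 1) p * mean_moment M X (k + 1) p"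
proof -
  have "0 < p" using p by simp
  then obtain w S where A: "\<And>n. finite (S n)" "\<And>n y. y \<in> S n \<Longrightarrow> 0 \<le> y" "\<And>n y. 0 \<le> w n y"
    "\<And>n. (\<Sum>y\<in>S n. w n y) = 1"
    "\<And>n k. ennreal (fin_moment (w n) (S n) p k) \<le> mean_moment M X k p"
    "\<And>k. (\<lambda>n. ennreal (fin_moment (w n) (S n) p k)) \<longlonglongrightarrow> mean_moment M X k p"
    by (rule mean_moment_approx) blast
  define c where "c = mean_moment M X (k - 1) p * mean_moment M X (k + 1) p"
  show ?thesis
  proof (cases "c = \<infinity>")
    case True
    then show ?thesis by (simp add: c_def)
  next
    case False
    then obtain r where r: "c = ennreal r" "0 \<le> r" by (cases c) auto
    have "ennreal (fin_moment (w n) (S n) p k) \<le> ennreal (sqrt r)" for n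
    proof -
      note nn = fin_moment_nonneg[OF A(1) A(2) A(3), of n]
      have "ennreal ((fin_moment (w n) (S n) p k)\<^sup>2) \<le>
          ennreal (fin_moment (w n) (S n) p (k - 1)) * ennreal (fin_moment (w n) (S n) p (k + 1))"
        using fin_moment_log_convex[OF A(1,2,3) p k, of n] nn
        by (simp add: ennreal_mult[symmetric] ennreal_leI)
      also have "\<dots> \<le> ennreal r"
        unfolding r(1)[symmetric] c_def by (intro mult_mono A(5)) auto
      finally have "(fin_moment (w n) (S n) p k)\<^sup>2 \<le> r"
        using r(2) by (simp add: ennreal_le_iff)
      then show ?thesis by (intro ennreal_leI real_le_rsqrt)
    qed
    then have "mean_moment M X k p \<le> ennreal (sqrt r)"
      by (intro LIMSEQ_le_const2[OF A(6)]) auto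
    then have "(mean_moment M X k p)\<^sup>2 \<le> (ennreal (sqrt r))\<^sup>2"
      by (intro power_mono) auto
    also have "\<dots> = c" using r by (simp add: ennreal_power)
    finally show ?thesis by (simp add: c_def)
  qed
qed

text \<open>Additive concavity is the form that passes to the limit; log-concavity then follows by
  AM-GM.\<close>

lemma mean_moment_log_concave:
  assumes p: "0 < p" "p < 1" and k: "2 \<le> k"
  shows "mean_moment M X (k - 1) p * mean_moment M X (k + 1) p \<le> (mean_moment M X k p)\<^sup>2"
proof (rule square_ge_mult_if_concave_ennreal)
  obtain w S where A: "\<And>n. finite (S n)" "\<And>n y. y \<in> S n \<Longrightarrow> 0 \<le> y" "\<And>n y. 0 \<le> w n y"
    "\<And>n. (\<Sum>y\<in>S n. w n y) = 1"
    "\<And>n k. ennreal (fin_moment (w n) (S n) p k) \<le> mean_moment M X k p"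
    "\<And>k. (\<lambda>n. ennreal (fin_moment (w n) (S n) p k)) \<longlonglongrightarrow> mean_moment M X k p"
    by (rule mean_moment_approx[OF p(1)]) blast
  show "mean_moment M X (k - 1) p + mean_moment M X (k + 1) p \<le> 2 * mean_moment M X k p"
  proof (rule LIMSEQ_le_const2[OF tendsto_add[OF A(6) A(6)]], intro exI[of _ 0] allI impI)
    fix n
    note nn = fin_moment_nonneg[OF A(1) A(2) A(3), of n]
    have "ennreal (fin_moment (w n) (S n) p (k - 1)) + ennreal (fin_moment (w n) (S n) p (k + 1)) \<le>
        ennreal (2 * fin_moment (w n) (S n) p k)"
      using fin_moment_concave[OF A(1,2,3) p A(4) k, of n] nn
      by (simp add: ennreal_plus[symmetric] ennreal_leI del: ennreal_plus)
    also have "\<dots> = 2 * ennreal (fin_moment (w n) (S n) p k)" by (simp add: ennreal_mult')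
    also have "\<dots> \<le> 2 * mean_moment M X k p" by (intro mult_left_mono A(5)) auto
    finally show "ennreal (fin_moment (w n) (S n) p (k - 1)) + ennreal (fin_moment (w n) (S n) p (k + 1)) \<le>
        2 * mean_moment M X k p" .
  qed
qed

section \<open>Vanishing and finiteness of positive moments do not depend on k\<close>

lemma mean_moment_1_le:
  assumes p: "0 < p" and k: "1 \<le> k"
  shows "mean_moment M X 1 p \<le> ennreal (real k powr p) * mean_moment M X k p"
proof -
  have "mean_moment M X 1 p \<le> (\<integral>\<^sup>+ \<omega>. ennreal (real k powr p) * ext_powr ((\<Sum>i\<in>{1..k}. X i \<omega>) / real k) p \<partial>M)"
    unfolding mean_moment_def
  proof (rule nn_integral_mono)
    fix \<omega>
    have "X 1 \<omega> powr p \<le> (\<Sum>i\<in>{1..k}. X i \<omega>) powr p"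
      using p k nonneg by (intro powr_mono2 member_le_sum) auto
    also have "\<dots> = real k powr p * ((\<Sum>i\<in>{1..k}. X i \<omega>) / real k) powr p"
      using k by (simp add: powr_mult[symmetric])
    finally show "ext_powr ((\<Sum>i\<in>{1..1}. X i \<omega>) / real 1) p \<le>
        ennreal (real k powr p) * ext_powr ((\<Sum>i\<in>{1..k}. X i \<omega>) / real k) p"
      using p by (simp add: ext_powr_pos ennreal_mult[symmetric] ennreal_leI)
  qed
  also have "\<dots> = ennreal (real k powr p) * mean_moment M X k p"
    unfolding mean_moment_def by (rule nn_integral_cmult) measurable
  finally show ?thesis .
qed

text \<open>The sample mean is at most one of the variables, so its power is at most the sum of
  their powers.\<close>

lemma mean_moment_le:
  assumes p: "0 < p" and k: "1 \<le> k"
  shows "mean_moment M X k p \<le> of_nat k * mean_moment M X 1 p"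
proof -
  have "mean_moment M X k p \<le> (\<integral>\<^sup>+ \<omega>. (\<Sum>i\<in>{1..k}. ennreal (X i \<omega> powr p)) \<partial>M)"
    unfolding mean_moment_def
  proof (rule nn_integral_mono)
    fix \<omega> :: 'a
    define x where "x = (\<Sum>i\<in>{1..k}. X i \<omega>) / real k"
    have "\<exists>i\<in>{1..k}. x \<le> X i \<omega>"
    proof (rule ccontr)
      assume "\<not> ?thesis"
      then have "(\<Sum>i\<in>{1..k}. X i \<omega>) < (\<Sum>i\<in>{1..k}. x)"
        using k by (intro sum_strict_mono) (auto simp: not_le)
      then show False using k by (simp add: x_def)
    qed
    then obtain i :: nat where i: "i \<in> {1..k}" "x \<le> X i \<omega>" by blast
    have "x powr p \<le> X i \<omega> powr p"
      using i p sample_mean_nonneg[of \<omega> k] by (intro powr_mono2) (auto simp: x_def)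
    also have "\<dots> \<le> (\<Sum>i\<in>{1..k}. X i \<omega> powr p)"
      using i by (intro member_le_sum) auto
    finally show "ext_powr ((\<Sum>i\<in>{1..k}. X i \<omega>) / real k) p \<le> (\<Sum>i\<in>{1..k}. ennreal (X i \<omega> powr p))"
      using p by (simp add: ext_powr_pos x_def ennreal_leI)
  qed
  also have "\<dots> = (\<Sum>i\<in>{1..k}. \<integral>\<^sup>+ \<omega>. ennreal (X i \<omega> powr p) \<partial>M)"
    using rv by (intro nn_integral_sum) (auto intro!: measurable_compose[OF rv])
  also have "\<dots> = (\<Sum>i\<in>{1..k}. mean_moment M X 1 p)"
  proof (rule sum.cong[OF refl])
    fix i :: nat assume "i \<in> {1..k}"
    then have "(\<integral>\<^sup>+ \<omega>. ennreal (X i \<omega> powr p) \<partial>M) = (\<integral>\<^sup>+ \<omega>. ennreal (X 1 \<omega> powr p) \<partial>M)"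
      by (intro nn_integral_ident[where f = "\<lambda>x. ennreal (x powr p)"]) auto
    then show "(\<integral>\<^sup>+ \<omega>. ennreal (X i \<omega> powr p) \<partial>M) = mean_moment M X 1 p"
      using p by (simp add: mean_moment_def ext_powr_pos)
  qed
  finally show ?thesis by simp
qed

lemma mean_moment_eq_0_iff:
  assumes p: "0 < p" and k: "1 \<le> k"
  shows "mean_moment M X k p = 0 \<longleftrightarrow> mean_moment M X 1 p = 0"
proof
  assume "mean_moment M X k p = 0"
  then have "mean_moment M X 1 p \<le> 0" using mean_moment_1_le[OF assms] by simp
  then show "mean_moment M X 1 p = 0" by simp
next
  assume "mean_moment M X 1 p = 0"
  then have "mean_moment M X k p \<le> 0" using mean_moment_le[OF assms] by simp
  then show "mean_moment M X k p = 0" by simp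
qed

lemma mean_moment_finite_iff:
  assumes p: "0 < p" and k: "1 \<le> k"
  shows "mean_moment M X k p < \<infinity> \<longleftrightarrow> mean_moment M X 1 p < \<infinity>"
proof
  assume "mean_moment M X k p < \<infinity>"
  then have "ennreal (real k powr p) * mean_moment M X k p < \<infinity>"
    by (simp add: ennreal_mult_less_top)
  then show "mean_moment M X 1 p < \<infinity>"
    by (rule le_less_trans[OF mean_moment_1_le[OF assms]])
next
  assume "mean_moment M X 1 p < \<infinity>"
  then have "of_nat k * mean_moment M X 1 p < \<infinity>"
    by (simp add: ennreal_mult_less_top of_nat_less_top)
  then show "mean_moment M X k p < \<infinity>"
    by (rule le_less_trans[OF mean_moment_le[OF assms]])
qed

section \<open>Product inequalities for i.i.d. variables\<close>

lemma mean_moment_0: "mean_moment M X k 0 = 1"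
proof -
  have "ext_powr x 0 = 1" for x by (simp add: ext_powr_def)
  then show ?thesis by (simp add: mean_moment_def emeasure_space_1)
qed

lemma mean_moment_log_convex:
  assumes "p \<in> {..0} \<union> {1..}" "2 \<le> k"
  shows "(mean_moment M X k p)\<^sup>2 \<le> mean_moment M X (k - 1) p * mean_moment M X (k + 1) p"
proof (cases "p = 0")
  case True
  then show ?thesis by (simp add: mean_moment_0)
next
  case False
  then have "p < 0 \<or> 1 \<le> p" using assms(1) by auto
  then show ?thesis
    using mean_moment_log_convex_of_neg[OF _ assms(2)] mean_moment_log_convex_of_ge_1[OF _ assms(2)] by blast
qed

text \<open>For p < 0 moments are positive and nonincreasing in k. For p >= 1 they are all zero or
  all positive, and all finite or all infinite; if they are zero, n > 0 makes the left product
  0.\<close>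

lemma prod_mean_moment_le:
  assumes p: "p \<in> {..0} \<union> {1..}" and n: "0 < n" and a: "is_partition n m a" and b: "is_partition n m b"
    and maj: "map real a \<prec>\<^sub>m\<^sub>a\<^sub>j map real b"
  shows "(\<Prod>j<n. mean_moment M X (a ! j) p) \<le> (\<Prod>j<n. mean_moment M X (b ! j) p)"
proof -
  have ab: "length a = n" "\<And>x. x \<in> set a \<Longrightarrow> 0 < x" "length b = n" "\<And>x. x \<in> set b \<Longrightarrow> 0 < x"
    using a b by (auto simp: is_partition_def)
  note karamata = prod_le_of_log_convex_ennreal[where \<beta> = "\<lambda>k. mean_moment M X k p", OF mean_moment_log_convex[OF p]
      _ _ ab maj]
  consider "p < 0" | "p = 0" | "1 \<le> p" using p by (cases p "0 :: real" rule: linorder_cases) auto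
  then show ?thesis
  proof cases
    case 1
    show ?thesis
      by (rule karamata)
        (use mean_moment_antimono_of_neg[OF 1] mean_moment_pos_of_neg[OF 1] in \<open>auto intro: le_less_trans\<close>)
  next
    case 2
    then show ?thesis by (simp add: mean_moment_0)
  next
    case 3
    then have p0: "0 < p" by simp
    show ?thesis
    proof (cases "mean_moment M X 1 p = 0")
      case True
      have "a ! 0 \<in> set a" using n ab by simp
      then have "mean_moment M X (a ! 0) p = 0"
        using True ab(2)[of "a ! 0"] mean_moment_eq_0_iff[OF p0, of "a ! 0"] by simp
      then have "(\<Prod>j<n. mean_moment M X (a ! j) p) = 0"
        using n by (intro prod_zero) auto
      then show ?thesis by (simp only: zero_le)
    next
      case False
      have "0 < mean_moment M X k p" if "1 \<le> k" for k
        using False mean_moment_eq_0_iff[OF p0 that] by (simp add: zero_less_iff_neq_zero)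
      moreover have "mean_moment M X (k + 1) p < \<infinity>" if "1 \<le> k" "mean_moment M X k p < \<infinity>" for k
        using that mean_moment_finite_iff[OF p0, of k] mean_moment_finite_iff[OF p0, of "k + 1"] by simp
      ultimately show ?thesis by (intro karamata) auto
    qed
  qed
qed

text \<open>If the first moment is 0 the smaller product is 0, and if it is infinite the larger one
  is infinite, both because n > 0. Otherwise all moments are positive and finite.\<close>

lemma prod_mean_moment_ge:
  assumes p: "0 < p" "p < 1" and n: "0 < n" and a: "is_partition n m a" and b: "is_partition n m b"
    and maj: "map real a \<prec>\<^sub>m\<^sub>a\<^sub>j map real b"
  shows "(\<Prod>j<n. mean_moment M X (b ! j) p) \<le> (\<Prod>j<n. mean_moment M X (a ! j) p)"
proof -
  have ab: "length a = n" "\<And>x. x \<in> set a \<Longrightarrow> 0 < x" "length b = n" "\<And>x. x \<in> set b \<Longrightarrow> 0 < x"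
    using a b by (auto simp: is_partition_def)
  have a1: "1 \<le> a ! j" and b1: "1 \<le> b ! j" if "j < n" for j
    using that ab(2)[of "a ! j"] ab(4)[of "b ! j"] ab(1,3) by (simp_all add: Suc_le_eq)
  consider "mean_moment M X 1 p = 0" | "mean_moment M X 1 p = \<infinity>" | "0 < mean_moment M X 1 p" "mean_moment M X 1 p < \<infinity>"
    by (metis infinity_ennreal_def less_top zero_less_iff_neq_zero)
  then show ?thesis
  proof cases
    case 1
    have "mean_moment M X (b ! 0) p = 0" using 1 mean_moment_eq_0_iff[OF p(1) b1[OF n]] by simp
    then have "(\<Prod>j<n. mean_moment M X (b ! j) p) = 0"
      using n by (intro prod_zero) auto
    then show ?thesis by (simp only: zero_le)
  next
    case 2
    have "mean_moment M X (a ! j) p = \<infinity>" if "j < n" for j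
      using 2 mean_moment_finite_iff[OF p(1) a1[OF that]] by (auto simp: less_top[symmetric])
    then have "(\<Prod>j<n. mean_moment M X (a ! j) p) = \<infinity> ^ n" by simp
    also have "(\<infinity> :: ennreal) ^ n = \<infinity>"
      using n by (simp add: power_eq_top_ennreal)
    finally show ?thesis by simp
  next
    case 3
    show ?thesis
    proof (rule prod_ge_of_log_concave_ennreal[OF mean_moment_log_concave[OF p] _ _ ab maj])
      fix k :: nat assume k: "1 \<le> k"
      show "mean_moment M X k p < \<infinity>" using 3 mean_moment_finite_iff[OF p(1) k] by simp
      show "0 < mean_moment M X k p"
        using 3 mean_moment_eq_0_iff[OF p(1) k] by (simp add: zero_less_iff_neq_zero)
    qed
  qed
qed

end

theorem corollary3:
  fixes M :: "'a measure" and X :: "nat \<Rightarrow> 'a \<Rightarrow> real"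
  assumes "prob_space M"
    and "prob_space.indep_vars M (\<lambda>_. borel) X {1..}"
    and "\<And>i j. 1 \<le> i \<Longrightarrow> 1 \<le> j \<Longrightarrow> distr M borel (X i) = distr M borel (X j)"
    and "\<And>i. 1 \<le> i \<Longrightarrow> AE \<omega> in M. 0 \<le> X i \<omega>"
  shows
    "(\<forall>(n::nat) (m::nat) (a::nat list) (b::nat list).
        0 < n \<longrightarrow> is_partition n m a \<longrightarrow> is_partition n m b \<longrightarrow> map real a \<prec>\<^sub>m\<^sub>a\<^sub>j map real b \<longrightarrow>
        (\<forall>p \<in> {..0} \<union> {1..}.
           (\<Prod>j<n. mean_moment M X (a ! j) p) \<le> (\<Prod>j<n. mean_moment M X (b ! j) p)) \<and>
        (\<forall>p \<in> {0<..<1}.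
           (\<Prod>j<n. mean_moment M X (a ! j) p) \<ge> (\<Prod>j<n. mean_moment M X (b ! j) p))) \<and>
     (\<forall>p \<in> {..0} \<union> {1..}. \<forall>k\<ge>2.
        (mean_moment M X k p)\<^sup>2 \<le> mean_moment M X (k - 1) p * mean_moment M X (k + 1) p) \<and>
     (\<forall>p \<in> {0<..<1}. \<forall>k\<ge>2.
        (mean_moment M X k p)\<^sup>2 \<ge> mean_moment M X (k - 1) p * mean_moment M X (k + 1) p)"
proof -
  interpret prob_space M by fact
  \<comment> \<open>The positive parts are again i.i.d., nonnegative everywhere, and almost surely
    equal to X for indices from 1 on, so all moments agree.\<close>
  define Y where "Y i \<omega> = max 0 (X i \<omega>)" for i \<omega>
  have rv: "X i \<in> borel_measurable M" if "1 \<le> i" for i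
    using assms(2) that by (auto simp: indep_vars_def)
  interpret Y: iid_nonneg M Y
  proof
    show "indep_vars (\<lambda>_. borel) Y {1..}"
      unfolding Y_def[abs_def] by (rule indep_vars_compose2[OF assms(2), where Y = "\<lambda>_ x. max 0 x"]) auto
    show "distr M borel (Y i) = distr M borel (Y 1)" if i: "1 \<le> i" for i
    proof -
      have "distr M borel (Y j) = distr (distr M borel (X j)) borel (\<lambda>x. max 0 x)" if "1 \<le> j" for j
        using rv[OF that] by (subst distr_distr) (auto simp: Y_def[abs_def] comp_def)
      from this[OF i] this[of 1] show ?thesis using assms(3)[OF i, of 1] by simp
    qed
  qed (simp add: Y_def)
  have eq: "mean_moment M X k p = mean_moment M Y k p" for k p
  proof -
    have "AE \<omega> in M. \<forall>i\<in>{1..k}. 0 \<le> X i \<omega>"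
      using assms(4) by (intro AE_finite_allI) auto
    then show ?thesis
      unfolding mean_moment_def
      by (intro nn_integral_cong_AE) (auto elim!: eventually_mono simp: Y_def intro!: arg_cong2[of _ _ _ _ ext_powr] sum.cong)
  qed
  show ?thesis
    unfolding eq
    using Y.prod_mean_moment_le Y.prod_mean_moment_ge Y.mean_moment_log_convex Y.mean_moment_log_concave
    by auto
qed

end
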